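(* For each integer $L\ge 2$ let $G_L(1)/2$ denote the number of ways to partition an $L\times L$ square into two connected regions (not necessarily of equal area), and let $C_L(1)$ denote the number of self-avoiding walks crossing an $L\times L$ square (WCAS). Then $G_L(1)/2$ has the same growth constant as WCAS; that is, the limit $\lim_{L\to\infty}(G_L(1)/2)^{1/L^2}$ exists and $$\lim_{L\to\infty}\left(\frac{G_L(1)}{2}\right)^{1/L^2}=\lambda:=\lim_{L\to\infty}C_L(1)^{1/L^2}.$$
   Context: Consider an $L\times L$ square (chessboard) made of $L^2$ unit cells. A region is a set of cells; it is connected if it is nonempty and any two of its cells can be joined by a path of cells in the region in which consecutive cells share an edge (i.e. it is a polyomino, possibly with holes). A generalised gerrymander configuration is a division of the $L\times L$ square into two connected regions, not necessarily of equal area. Let $g_{L,k}$ be the number of such configurations with one region having area $k$ and the other having area $L^2-k$, where each configuration is counted once for each of its regions of area $k$ (so over all $k$ every configuration is counted exactly twice, once for its region of area $k$ and once for its region of area $L^2-k$). The gerrymander polynomial is $G_L(q)=\sum_{k=1}^{L^2-1} g_{L,k}q^k$, so that $G_L(1)/2$ is the number of unordered partitions of the set of cells of the square into two connected regions. (Configurations related by rotation or reflection of the square are counted as different.) A self-avoiding walk is a sequence of distinct vertices of $\mathbb{Z}^2$, each a nearest neighbour of its predecessor. A WCAS (walk crossing a square) is a self-avoiding walk from $(0,0)$ to $(L,L)$ all of whose vertices lie in $\{0,1,\dots,L\}^2$; $C_L(1)$ is the number of such walks (of any length). It is a known result that the limit $\lambda=\lim_{L\to\infty}C_L(1)^{1/L^2}$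 exists; $\lambda$ is called the growth constant of WCAS. *)

theory Defs
  imports Complex_Main "HOL-Library.Disjoint_Sets" "HOL-Computational_Algebra.Polynomial"
begin

text \<open>
  A unit cell is represented by the integer coordinates of its lower left corner, so the same
  relation expresses that two cells share an edge and that two vertices of the square lattice
  are nearest neighbours.
\<close>

definition grid_adj :: "int \<times> int \<Rightarrow> int \<times> int \<Rightarrow> bool" where
  "grid_adj u v \<longleftrightarrow> \<bar>fst u - fst v\<bar> + \<bar>snd u - snd v\<bar> = 1"

definition cells :: "nat \<Rightarrow> (int \<times> int) set" where
  "cells L = {0..<int L} \<times> {0..<int L}"

definition connected_region :: "(int \<times> int) set \<Rightarrow> bool" where
  "connected_region R \<longleftrightarrow> R \<noteq> {} \<and>
     (\<forall>a\<in>R. \<forall>b\<in>R. \<exists>p. p \<noteq> [] \<and> hd p = a \<and> last p = b \<and> set p \<subseteq> R \<and> successively grid_adj p)"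

definition configurations :: "nat \<Rightarrow> (int \<times> int) set set set" where
  "configurations L =
     {P. partition_on (cells L) P \<and> card P = 2 \<and> (\<forall>R\<in>P. connected_region R)}"

text \<open>
  Configurations are unordered; pairing each one with a distinguished region counts it once for
  each of its regions of area \<open>k\<close>, hence twice if both regions have area \<open>k\<close>.
\<close>

definition gerrymander_count :: "nat \<Rightarrow> nat \<Rightarrow> nat" where
  "gerrymander_count L k = card {(P, R). P \<in> configurations L \<and> R \<in> P \<and> card R = k}"

definition gerrymander_poly :: "nat \<Rightarrow> real poly" where
  "gerrymander_poly L = (\<Sum>k = 1..L\<^sup>2 - 1. monom (real (gerrymander_count L k)) k)"

text \<open>A walk is the list of its vertices.\<close>

definition self_avoiding_walk :: "(int \<times> int) list \<Rightarrow> bool" where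
  "self_avoiding_walk w \<longleftrightarrow> w \<noteq> [] \<and> distinct w \<and> successively grid_adj w"

definition WCAS :: "nat \<Rightarrow> (int \<times> int) list set" where
  "WCAS L = {w. self_avoiding_walk w \<and> hd w = (0, 0) \<and> last w = (int L, int L) \<and>
                set w \<subseteq> {0..int L} \<times> {0..int L}}"

definition wcas_growth_constant :: real where
  "wcas_growth_constant = lim (\<lambda>L. real (card (WCAS L)) powr (1 / real (L\<^sup>2)))"

lemma finite_WCAS: "finite (WCAS L)"
proof (rule finite_subset)
  show "WCAS L \<subseteq> {w. set w \<subseteq> {0..int L} \<times> {0..int L} \<and> distinct w}"
    by (auto simp: WCAS_def self_avoiding_walk_def)
  show "finite {w. set w \<subseteq> {0..int L} \<times> {0..int L} \<and> distinct w}"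
    by (rule finite_subset_distinct) simp
qed

lemma finite_configurations: "finite (configurations L)"
proof (rule finite_subset)
  show "configurations L \<subseteq> Pow (Pow (cells L))"
    by (auto simp: configurations_def partition_on_def)
qed (simp add: cells_def)

lemma area_of_region:
  assumes "P \<in> configurations L" "R \<in> P"
  shows "card R \<in> {1..L\<^sup>2 - 1}"
proof -
  have P: "partition_on (cells L) P" "card P = 2"
    using assms(1) by (auto simp: configurations_def)
  have fin: "finite (cells L)" and card: "card (cells L) = L\<^sup>2"
    by (simp_all add: cells_def power2_eq_square)
  obtain S where S: "S \<in> P" "S \<noteq> R"
    using P(2) assms(2) by (auto simp: card_2_iff)
  have sub: "R \<subseteq> cells L" "S \<subseteq> cells L"
    using P(1) assms(2) S(1) by (auto simp: partition_on_def)
  have ne: "R \<noteq> {}" "S \<noteq> {}" "R \<inter> S = {}"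
    using P(1) assms(2) S by (auto simp: partition_on_def disjoint_def)
  have "R \<subset> cells L"
    using sub ne by blast
  then have "card R < L\<^sup>2"
    using psubset_card_mono[OF fin] card by simp
  moreover have "card R > 0"
    using ne(1) finite_subset[OF sub(1) fin] by (simp add: card_gt_0_iff)
  ultimately show ?thesis
    by auto
qed

lemma half_gerrymander_poly_1:
  "poly (gerrymander_poly L) 1 / 2 = real (card (configurations L))"
proof -
  define A where "A k = {(P, R). P \<in> configurations L \<and> R \<in> P \<and> card R = k}" for k
  have finP: "finite P" if "P \<in> configurations L" for P
    using that by (auto simp: configurations_def card_2_iff)
  have finS: "finite (Sigma (configurations L) (\<lambda>P. P))"
    using finite_configurations finP by blast
  have U: "(\<Union>k\<in>{1..L\<^sup>2 - 1}. A k) = Sigma (configurations L) (\<lambda>P. P)"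
    using area_of_region unfolding A_def by blast
  have "(\<Sum>k = 1..L\<^sup>2 - 1. gerrymander_count L k) = (\<Sum>k = 1..L\<^sup>2 - 1. card (A k))"
    by (simp add: gerrymander_count_def A_def)
  also have "\<dots> = card (\<Union>k\<in>{1..L\<^sup>2 - 1}. A k)"
  proof (rule card_UN_disjoint[symmetric])
    show "\<forall>k\<in>{1..L\<^sup>2 - 1}. finite (A k)"
      by (intro ballI finite_subset[OF _ finS]) (auto simp: A_def)
  qed (auto simp: A_def)
  also have "\<dots> = (\<Sum>P\<in>configurations L. card P)"
    unfolding U using finite_configurations finP by (intro card_SigmaI) auto
  also have "\<dots> = 2 * card (configurations L)"
    by (simp add: configurations_def)
  finally have "real (\<Sum>k = 1..L\<^sup>2 - 1. gerrymander_count L k) = 2 * real (card (configurations L))"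
    by simp
  then show ?thesis
    by (simp add: gerrymander_poly_def poly_sum poly_monom)
qed

end

theory Submission
  imports Defs
begin

text \<open>
  The two counts bound each other up to a polynomial factor and a bounded change of the side
  length: \<open>W(L) \<le> G(L + 2)\<close> and \<open>G(L) \<le> L\<^sup>2 W(L)\<close>, where \<open>W(L)\<close> is the number of crossing walks
  and \<open>G(L)\<close> the number of configurations.  Such changes disappear in the root of order \<open>L\<^sup>2\<close>, so
  it remains to see that \<open>W(L)\<close> has a growth rate.

  The link between walks and regions is a discrete duality that needs no Jordan curve theorem.
  The boundary of a set of cells is a set of lattice edges that is even at every vertex; conversely
  an even edge set is the boundary of the set of cells from which a vertical ray crosses it an even
  number of times (\<open>ray_parity_column\<close>).  A walk from \<open>(a, a)\<close> to \<open>(b, b)\<close> becomes even when it is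
  prolonged by a ray to the left and a ray to the right, and it is then the boundary of the set of
  cells above it (\<open>boundary_above\<close>).

  For \<open>W(L) \<le> G(L + 2)\<close>, the walk is surrounded by a ring of cells.  Then the cells above and below
  it are connected (\<open>connected_side\<close>), because the boundary of a closed part of one side is an even
  subset of the path, hence touches all of it.

  For \<open>G(L) \<le> L\<^sup>2 W(L)\<close>, a region is enlarged by the cells outside of the square that lie above the
  two rays.  The boundary of the enlarged set joins the corners \<open>(0, 0)\<close> and \<open>(L, L)\<close>, again by parity
  (\<open>corners_joined\<close>), and so contains a crossing walk.  Since both regions are connected and are not
  separated internally by this boundary, each lies on one side of the walk.  If they are attached to
  different parts of the outside, the walk determines the configuration
  (\<open>region_above_crossing\<close>).  The remaining case is that of a region enclosed by the other one.  It
  is attached to the upper edge by a column of cells above one of its topmost cells; the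
  factor \<open>L\<^sup>2\<close> accounts for the choice of this cell (\<open>region_from_crossing\<close>).

  For the growth rate, an odd number of walks in neighbouring squares, every second one reflected,
  can be joined to a walk that crosses a strip, and an odd number of strips to a walk that crosses a
  large square.  This gives \<open>W(m)\<close> to the power \<open>(2j + 1)\<^sup>2\<close> as a lower bound for
  \<open>W((2j + 1)(m + 1) - 1)\<close> (\<open>card_WCAS_tiling\<close>), and the limit exists as in Fekete's lemma
  (\<open>tiling_limit\<close>).
\<close>

section \<open>Connected regions\<close>

lemma grid_adj_commute: "grid_adj u v \<longleftrightarrow> grid_adj v u"
  by (auto simp: grid_adj_def abs_minus_commute)

lemma grid_adj_cases:
  assumes "grid_adj (x, y) v"
  obtains "v = (x + 1, y)" | "v = (x - 1, y)" | "v = (x, y + 1)" | "v = (x, y - 1)"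
proof -
  obtain x' y' where v: "v = (x', y')"
    by (cases v)
  have "\<bar>x - x'\<bar> + \<bar>y - y'\<bar> = 1"
    using assms by (simp add: grid_adj_def v)
  then have "x' = x + 1 \<and> y' = y \<or> x' = x - 1 \<and> y' = y \<or> x' = x \<and> y' = y + 1 \<or> x' = x \<and> y' = y - 1"
    by arith
  then show ?thesis
    using that v by blast
qed

lemma grid_adj_iff:
  "grid_adj (x, y) v \<longleftrightarrow> v = (x + 1, y) \<or> v = (x - 1, y) \<or> v = (x, y + 1) \<or> v = (x, y - 1)"
  by (rule iffI, erule grid_adj_cases) (auto simp: grid_adj_def)

lemma grid_adj_steps [simp]:
  "grid_adj (x, y) (x + 1, y)" "grid_adj (x, y) (x - 1, y)"
  "grid_adj (x, y) (x, y + 1)" "grid_adj (x, y) (x, y - 1)"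
  "grid_adj (x + 1, y) (x, y)" "grid_adj (x - 1, y) (x, y)"
  "grid_adj (x, y + 1) (x, y)" "grid_adj (x, y - 1) (x, y)"
  by (simp_all add: grid_adj_def)

definition adj_closed_in :: "(int \<times> int) set \<Rightarrow> (int \<times> int) set \<Rightarrow> bool" where
  "adj_closed_in R K \<longleftrightarrow> (\<forall>u\<in>K. \<forall>v\<in>R. grid_adj u v \<longrightarrow> v \<in> K)"

lemma adj_closed_inD: "adj_closed_in R K \<Longrightarrow> u \<in> K \<Longrightarrow> v \<in> R \<Longrightarrow> grid_adj u v \<Longrightarrow> v \<in> K"
  by (auto simp: adj_closed_in_def)

lemma adj_closed_in_Diff: "adj_closed_in R K \<Longrightarrow> adj_closed_in R (R - K)"
  unfolding adj_closed_in_def using grid_adj_commute by blast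

text \<open>
  Connectedness is exploited through sets closed under adjacency instead of paths: a connected
  region cannot be left partially covered by such a set.
\<close>

lemma connected_region_subset:
  assumes R: "connected_region R" and K: "adj_closed_in R K" and a: "a \<in> K" "a \<in> R"
  shows "R \<subseteq> K"
proof
  fix b assume "b \<in> R"
  with R a obtain p where p: "p \<noteq> []" "hd p = a" "last p = b" "set p \<subseteq> R" "successively grid_adj p"
    unfolding connected_region_def by blast
  have "last p \<in> K" if "p \<noteq> []" "set p \<subseteq> R" "successively grid_adj p" "hd p \<in> K" for p
    using that
  proof (induction p rule: induct_list012)
    case (3 c d p)
    then have "d \<in> K"
      using adj_closed_inD[OF K, of c d] by simp
    with 3 show ?case by simp
  qed simp_all
  from this[OF p(1,4,5)] have "last p \<in> K"
    using p(2) a(1) by simp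
  with p show "b \<in> K" by simp
qed

text \<open>
  The set reached from a cell is closed, and so is its complement, because adjacency is symmetric.
  If both were nonempty, both would contain the base point \<^term>\<open>c\<close>.
\<close>

lemma connected_regionI:
  assumes "R \<noteq> {}"
    and c: "\<And>K. K \<subseteq> R \<Longrightarrow> K \<noteq> {} \<Longrightarrow> adj_closed_in R K \<Longrightarrow> c \<in> K"
  shows "connected_region R"
  unfolding connected_region_def
proof (intro conjI ballI)
  show "R \<noteq> {}" by fact
next
  fix a b assume a: "a \<in> R" and b: "b \<in> R"
  define joined where
    "joined v p \<longleftrightarrow> p \<noteq> [] \<and> hd p = a \<and> last p = v \<and> set p \<subseteq> R \<and> successively grid_adj p" for v p
  define K where "K = {v. \<exists>p. joined v p}"
  have "joined a [a]"
    using a by (simp add: joined_def)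
  then have "a \<in> K"
    by (auto simp: K_def)
  have sub: "K \<subseteq> R"
    by (auto simp: K_def joined_def dest: last_in_set)
  have closed: "adj_closed_in R K"
    unfolding adj_closed_in_def
  proof (intro ballI impI)
    fix u v assume "u \<in> K" "v \<in> R" "grid_adj u v"
    then obtain p where "joined u p" by (auto simp: K_def)
    then have "joined v (p @ [v])"
      using \<open>v \<in> R\<close> \<open>grid_adj u v\<close> by (auto simp: joined_def successively_append_iff)
    then show "v \<in> K" by (auto simp: K_def)
  qed
  have "c \<in> K"
    using c[OF sub _ closed] \<open>a \<in> K\<close> by blast
  moreover have "R - K = {}"
  proof (rule ccontr)
    assume "R - K \<noteq> {}"
    then have "c \<in> R - K"
      using c[OF _ _ adj_closed_in_Diff[OF closed]] by blast
    with \<open>c \<in> K\<close> show False by simp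
  qed
  ultimately show "\<exists>p. p \<noteq> [] \<and> hd p = a \<and> last p = b \<and> set p \<subseteq> R \<and> successively grid_adj p"
    using b by (auto simp: K_def joined_def)
qed

lemma connected_region_rectangle:
  fixes a b c d :: int
  assumes "a \<le> b" "c \<le> d"
  shows "connected_region ({a..b} \<times> {c..d})" (is "connected_region ?R")
proof (rule connected_regionI[where c = "(a, c)"])
  show "?R \<noteq> {}" using assms by auto
next
  fix K assume K: "K \<subseteq> ?R" "K \<noteq> {}" "adj_closed_in ?R K"
  then obtain x y where xy: "(x, y) \<in> K" by auto
  then have le: "a \<le> x" "x \<le> b" "c \<le> y" "y \<le> d"
    using K by auto
  from \<open>a \<le> x\<close> xy \<open>x \<le> b\<close> have "(a, y) \<in> K"
  proof (induction x rule: int_ge_induct)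
    case (step i)
    then have "(i, y) \<in> K"
      using adj_closed_inD[OF K(3), of "(i + 1, y)" "(i, y)"] le by auto
    with step show ?case by simp
  qed
  from \<open>c \<le> y\<close> this \<open>y \<le> d\<close> show "(a, c) \<in> K"
  proof (induction y rule: int_ge_induct)
    case (step i)
    then have "(a, i) \<in> K"
      using adj_closed_inD[OF K(3), of "(a, i + 1)" "(a, i)"] le by auto
    with step show ?case by simp
  qed
qed

section \<open>Self-avoiding walks between two vertices\<close>

definition walks :: "(int \<times> int) set \<Rightarrow> int \<times> int \<Rightarrow> int \<times> int \<Rightarrow> (int \<times> int) list set" where
  "walks S p q = {w. self_avoiding_walk w \<and> hd w = p \<and> last w = q \<and> set w \<subseteq> S}"

lemma finite_walks: "finite S \<Longrightarrow> finite (walks S p q)"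
  by (rule finite_subset[OF _ finite_subset_distinct[of S]])
     (auto simp: walks_def self_avoiding_walk_def)

lemma WCAS_eq_walks: "WCAS L = walks ({0..int L} \<times> {0..int L}) (0, 0) (int L, int L)"
  by (auto simp: WCAS_def walks_def)

lemma card_walks_mono:
  assumes "finite T" "S \<subseteq> T"
  shows "card (walks S p q) \<le> card (walks T p q)"
  by (intro card_mono finite_walks assms) (use assms in \<open>auto simp: walks_def\<close>)

lemma walks_map:
  assumes "inj \<phi>" and adj: "\<And>u v. grid_adj u v \<Longrightarrow> grid_adj (\<phi> u) (\<phi> v)"
    and "w \<in> walks S p q"
  shows "map \<phi> w \<in> walks (\<phi> ` S) (\<phi> p) (\<phi> q)"
proof -
  have w: "w \<noteq> []" "distinct w" "successively grid_adj w" "hd w = p" "last w = q" "set w \<subseteq> S"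
    using assms(3) by (auto simp: walks_def self_avoiding_walk_def)
  have "successively (\<lambda>u v. grid_adj (\<phi> u) (\<phi> v)) w"
    using w(3) by (rule successively_mono) (rule adj)
  moreover have "distinct (map \<phi> w)"
    using w(2) assms(1) by (simp add: distinct_map inj_on_subset[of \<phi> UNIV])
  ultimately show ?thesis
    using w by (auto simp: walks_def self_avoiding_walk_def hd_map last_map successively_map)
qed

text \<open>
  Used with reflections and translations, which move a walk to another place or orientation.
\<close>

lemma card_walks_image:
  assumes "inj \<phi>" "\<And>u v. grid_adj u v \<Longrightarrow> grid_adj (\<phi> u) (\<phi> v)" "finite S"
  shows "card (walks S p q) \<le> card (walks (\<phi> ` S) (\<phi> p) (\<phi> q))"
proof (rule card_inj_on_le[where f = "map \<phi>"])
  show "inj_on (map \<phi>) (walks S p q)"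
    using assms(1) by (simp add: inj_on_def inj_map_eq_map)
  show "map \<phi> ` walks S p q \<subseteq> walks (\<phi> ` S) (\<phi> p) (\<phi> q)"
    using walks_map[OF assms(1,2)] by blast
  show "finite (walks (\<phi> ` S) (\<phi> p) (\<phi> q))"
    using assms(3) by (simp add: finite_walks)
qed

text \<open>
  Walks in disjoint sets can be joined by an edge, and the two parts are recovered by
  restricting the joined walk to either set.
\<close>

lemma card_walks_join:
  assumes fin: "finite S" "finite T" and disj: "S \<inter> T = {}" and adj: "grid_adj q p'"
  shows "card (walks S p q) * card (walks T p' q') \<le> card (walks (S \<union> T) p q')"
proof -
  let ?f = "\<lambda>(u, v). u @ v :: (int \<times> int) list"
  have "card (walks S p q \<times> walks T p' q') \<le> card (walks (S \<union> T) p q')"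
  proof (rule card_inj_on_le[where f = ?f])
    have "filter (\<lambda>c. c \<in> S) (u @ v) = u \<and> filter (\<lambda>c. c \<in> T) (u @ v) = v"
      if "u \<in> walks S p q" "v \<in> walks T p' q'" for u v
    proof -
      have "set u \<subseteq> S" "set v \<subseteq> T"
        using that by (auto simp: walks_def)
      then have "filter (\<lambda>c. c \<in> S) u = u" "filter (\<lambda>c. c \<in> S) v = []"
        "filter (\<lambda>c. c \<in> T) u = []" "filter (\<lambda>c. c \<in> T) v = v"
        using disj by (auto simp: filter_id_conv filter_empty_conv)
      then show ?thesis by simp
    qed
    then show "inj_on ?f (walks S p q \<times> walks T p' q')"
      by (intro inj_on_inverseI[where
            g = "\<lambda>w. (filter (\<lambda>c. c \<in> S) w, filter (\<lambda>c. c \<in> T) w)"]) auto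
    show "?f ` (walks S p q \<times> walks T p' q') \<subseteq> walks (S \<union> T) p q'"
      using disj adj
      by (force simp: walks_def self_avoiding_walk_def successively_append_iff)
    show "finite (walks (S \<union> T) p q')"
      using fin by (simp add: finite_walks)
  qed
  then show ?thesis by (simp add: card_cartesian_product)
qed

text \<open>A shortest path is self-avoiding: a repeated vertex is an opportunity for a short cut.\<close>

lemma rtranclp_imp_distinct_path:
  assumes "r\<^sup>*\<^sup>* a b"
  shows "\<exists>p. p \<noteq> [] \<and> hd p = a \<and> last p = b \<and> distinct p \<and> successively r p
    \<and> (\<forall>v\<in>set p. r\<^sup>*\<^sup>* a v)"
  using assms
proof (induction rule: rtranclp_induct)
  case base
  show ?case by (rule exI[of _ "[a]"]) simp
next
  case (step b c)
  then obtain p where p: "p \<noteq> []" "hd p = a" "last p = b" "distinct p" "successively r p"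
      "\<forall>v\<in>set p. r\<^sup>*\<^sup>* a v"
    by blast
  show ?case
  proof (cases "c \<in> set p")
    case True
    then obtain p1 p2 where eq: "p = p1 @ c # p2"
      by (auto simp: in_set_conv_decomp)
    with p have "hd (p1 @ [c]) = a" "distinct (p1 @ [c])" "successively r (p1 @ [c])"
      "\<forall>v\<in>set (p1 @ [c]). r\<^sup>*\<^sup>* a v"
      by (auto simp: successively_append_iff hd_append)
    then show ?thesis
      by (intro exI[of _ "p1 @ [c]"]) simp
  next
    case False
    then show ?thesis
      using p step.hyps by (intro exI[of _ "p @ [c]"]) (auto simp: successively_append_iff)
  qed
qed

section \<open>Boundaries of cell sets and even edge sets\<close>

text \<open>
  Two neighbouring lattice vertices span a segment that separates two cells.  The cell
  \<^term>\<open>(x, y)\<close> has \<^term>\<open>(x, y)\<close> as its lower left corner, so a horizontal segment starting at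
  \<^term>\<open>(x, y)\<close> lies between \<^term>\<open>(x, y)\<close> and \<^term>\<open>(x, y - 1)\<close>, a vertical one between
  \<^term>\<open>(x, y)\<close> and \<^term>\<open>(x - 1, y)\<close>.  The boundary of a set of cells consists of the segments
  that separate a cell of the set from a cell outside, seen as a relation between their ends.
\<close>

definition boundary :: "(int \<times> int) set \<Rightarrow> int \<times> int \<Rightarrow> int \<times> int \<Rightarrow> bool" where
  "boundary A u v \<longleftrightarrow>
     (\<exists>x y. {u, v} = {(x, y), (x + 1, y)} \<and> ((x, y) \<in> A) \<noteq> ((x, y - 1) \<in> A)) \<or>
     (\<exists>x y. {u, v} = {(x, y), (x, y + 1)} \<and> ((x, y) \<in> A) \<noteq> ((x - 1, y) \<in> A))"

lemma boundary_commute: "boundary A u v \<longleftrightarrow> boundary A v u"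
  by (simp add: boundary_def insert_commute)

lemma boundary_steps [simp]:
  "boundary A (x, y) (x + 1, y) \<longleftrightarrow> ((x, y) \<in> A) \<noteq> ((x, y - 1) \<in> A)"
  "boundary A (x, y) (x - 1, y) \<longleftrightarrow> ((x - 1, y) \<in> A) \<noteq> ((x - 1, y - 1) \<in> A)"
  "boundary A (x, y) (x, y + 1) \<longleftrightarrow> ((x, y) \<in> A) \<noteq> ((x - 1, y) \<in> A)"
  "boundary A (x, y) (x, y - 1) \<longleftrightarrow> ((x, y - 1) \<in> A) \<noteq> ((x - 1, y - 1) \<in> A)"
  by (auto simp: boundary_def doubleton_eq_iff)

lemma boundary_imp_adj: "boundary A u v \<Longrightarrow> grid_adj u v"
  by (auto simp: boundary_def doubleton_eq_iff)

lemma boundary_separates: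
  assumes "grid_adj c d"
  obtains u v where "\<forall>A. boundary A u v \<longleftrightarrow> (c \<in> A) \<noteq> (d \<in> A)"
    "{u, v} \<subseteq> {fst c..fst c + 1} \<times> {snd c..snd c + 1}"
proof -
  obtain x y where c: "c = (x, y)" by (cases c)
  show ?thesis
    using assms unfolding c
  proof (cases rule: grid_adj_cases)
    case 1
    show ?thesis by (rule that[of "(x + 1, y)" "(x + 1, y + 1)"]) (auto simp: 1 c)
  next
    case 2
    show ?thesis by (rule that[of "(x, y)" "(x, y + 1)"]) (auto simp: 2 c)
  next
    case 3
    have "boundary A (x, y + 1) (x + 1, y + 1) \<longleftrightarrow> ((x, y) \<in> A) \<noteq> ((x, y + 1) \<in> A)" for A
      using boundary_steps(1)[of A x "y + 1"] by auto
    then show ?thesis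
      by (intro that[of "(x, y + 1)" "(x + 1, y + 1)"]) (auto simp: 3 c)
  next
    case 4
    show ?thesis by (rule that[of "(x, y)" "(x + 1, y)"]) (auto simp: 4 c)
  qed
qed

text \<open>
  The number of edges of \<^term>\<open>F\<close> at the vertex is even, written with exclusive or.
\<close>

definition even_at :: "(int \<times> int \<Rightarrow> int \<times> int \<Rightarrow> bool) \<Rightarrow> int \<times> int \<Rightarrow> bool" where
  "even_at F u \<longleftrightarrow> (case u of (x, y) \<Rightarrow>
     (F (x, y) (x + 1, y) \<noteq> F (x, y) (x - 1, y)) = (F (x, y) (x, y + 1) \<noteq> F (x, y) (x, y - 1)))"

text \<open>
  On a tour through the four cells around a vertex, the set is entered as often as it is left.
\<close>

lemma even_at_boundary: "even_at (boundary A) u"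
  by (cases u) (auto simp: even_at_def)

text \<open>
  An even number of edges out of two candidates means both or none.  Hence an even edge set that
  is contained in a path contains, with one edge, the whole path.
\<close>

lemma even_at_two_edges:
  assumes "even_at F u" "grid_adj u p" "grid_adj u q" "p \<noteq> q"
    and "\<And>v. grid_adj u v \<Longrightarrow> F u v \<Longrightarrow> v = p \<or> v = q"
  shows "F u p \<longleftrightarrow> F u q"
proof -
  obtain x y where u: "u = (x, y)" by (cases u)
  have no: "v = p \<or> v = q \<or> \<not> F (x, y) v" if "grid_adj (x, y) v" for v
    using assms(5) that u by blast
  note dirs = no[OF grid_adj_steps(1)] no[OF grid_adj_steps(2)]
    no[OF grid_adj_steps(3)] no[OF grid_adj_steps(4)]
  show ?thesis
    using assms(2,3) unfolding u grid_adj_iff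
    by (elim disjE) (use dirs assms(1,4) in \<open>simp_all add: u even_at_def\<close>)
qed

lemma even_atI_two_edges:
  assumes "grid_adj u p" "grid_adj u q" "p \<noteq> q"
    and "\<And>v. F u v \<longleftrightarrow> v = p \<or> v = q"
  shows "even_at F u"
proof -
  obtain x y where u: "u = (x, y)" by (cases u)
  show ?thesis
    using assms(1-3) unfolding u grid_adj_iff by (auto simp: even_at_def assms(4)[unfolded u])
qed

text \<open>
  Ray casting: the vertical ray that starts in the cell \<^term>\<open>(x, y)\<close> and points upwards crosses
  these horizontal edges.  The height bound \<^term>\<open>b\<close> only serves to make the set finite; it lies
  above all edges in the applications.
\<close>

definition ray_parity :: "(int \<times> int \<Rightarrow> int \<times> int \<Rightarrow> bool) \<Rightarrow> int \<Rightarrow> int \<Rightarrow> int \<Rightarrow> bool" where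
  "ray_parity F b x y \<longleftrightarrow> odd (card {j \<in> {y<..b}. F (x, j) (x + 1, j)})"

lemma ray_parity_above [simp]: "y \<ge> b \<Longrightarrow> \<not> ray_parity F b x y"
  by (simp add: ray_parity_def)

lemma ray_parity_step:
  assumes high: "\<And>u v. F u v \<Longrightarrow> snd u \<le> b"
  shows "ray_parity F b x (y - 1) \<longleftrightarrow> ray_parity F b x y \<noteq> F (x, y) (x + 1, y)"
proof (cases "F (x, y) (x + 1, y)")
  case True
  then have "y \<le> b" using high by fastforce
  with True have "{j \<in> {y - 1<..b}. F (x, j) (x + 1, j)} = insert y {j \<in> {y<..b}. F (x, j) (x + 1, j)}"
    by (auto simp: le_less)
  moreover have "finite {j \<in> {y<..b}. F (x, j) (x + 1, j)}"
    by (rule finite_subset[of _ "{y<..b}"]) auto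
  ultimately have "card {j \<in> {y - 1<..b}. F (x, j) (x + 1, j)} = Suc (card {j \<in> {y<..b}. F (x, j) (x + 1, j)})"
    by (simp only: card_insert_disjoint) (subst card_insert_disjoint, auto)
  with True show ?thesis by (simp add: ray_parity_def)
next
  case False
  then have "{j \<in> {y - 1<..b}. F (x, j) (x + 1, j)} = {j \<in> {y<..b}. F (x, j) (x + 1, j)}"
    by (auto simp: order.strict_iff_order)
  with False show ?thesis by (simp add: ray_parity_def)
qed

text \<open>
  Add the degrees of the vertices \<^term>\<open>(x + 1, j)\<close> with \<^term>\<open>y < j\<close>, all of them even.  The
  horizontal edges counted in this way are those met by the two rays.  A vertical edge is counted
  at both of its ends and drops out modulo two, except for the one whose lower end is
  \<^term>\<open>(x + 1, y)\<close>.  This one edge therefore decides whether the parities of the two rays differ.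
\<close>

lemma ray_parity_column:
  assumes sym: "\<And>u v. F u v \<longleftrightarrow> F v u"
    and high: "\<And>u v. F u v \<Longrightarrow> snd u \<le> b"
    and even: "\<And>j. y < j \<Longrightarrow> even_at F (x + 1, j)"
  shows "ray_parity F b x y \<noteq> ray_parity F b (x + 1) y \<longleftrightarrow> F (x + 1, y) (x + 1, y + 1)"
proof (cases "y \<ge> b")
  case True
  then have "\<not> F (x + 1, y + 1) (x + 1, y)"
    using high by fastforce
  then show ?thesis
    using True sym by auto
next
  case False
  then have "y \<le> b" by simp
  then show ?thesis
    using even
  proof (induction y rule: int_le_induct)
    case base
    have "\<not> F (x + 1, b + 1) (x + 1, b)"
      using high by fastforce
    then show ?case
      using sym by auto
  next
    case (step y)
    have IH: "ray_parity F b x y \<noteq> ray_parity F b (x + 1) y \<longleftrightarrow> F (x + 1, y) (x + 1, y + 1)"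
      using step by simp
    have "even_at F (x + 1, y)"
      using step.prems[of y] by simp
    then have "(F (x + 1, y) (x + 1 + 1, y) \<noteq> F (x, y) (x + 1, y))
        = (F (x + 1, y) (x + 1, y + 1) \<noteq> F (x + 1, y - 1) (x + 1, y))"
      using sym by (auto simp: even_at_def)
    then show ?case
      using IH ray_parity_step[where F = F and b = b, OF high]
      by auto
  qed
qed

section \<open>Walks crossing a square, prolonged by two rays\<close>

definition trace :: "(int \<Rightarrow> int \<times> int) \<Rightarrow> int \<times> int \<Rightarrow> int \<times> int \<Rightarrow> bool" where
  "trace f u v \<longleftrightarrow> (\<exists>i. {u, v} = {f i, f (i + 1)})"

lemma trace_commute: "trace f u v \<longleftrightarrow> trace f v u"
  by (simp add: trace_def insert_commute)

lemma trace_from: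
  assumes "inj f"
  shows "trace f (f i) v \<longleftrightarrow> v = f (i - 1) \<or> v = f (i + 1)"
proof
  assume "trace f (f i) v"
  then obtain j where "{f i, v} = {f j, f (j + 1)}"
    by (auto simp: trace_def)
  then show "v = f (i - 1) \<or> v = f (i + 1)"
    using assms by (auto simp: doubleton_eq_iff inj_eq)
next
  have "{f i, f (i - 1)} = {f (i - 1), f (i - 1 + 1)}"
    by auto
  then show "v = f (i - 1) \<or> v = f (i + 1) \<Longrightarrow> trace f (f i) v"
    unfolding trace_def by blast
qed

locale bi_infinite_path =
  fixes f :: "int \<Rightarrow> int \<times> int"
  assumes inj: "inj f" and adj: "grid_adj (f i) (f (i + 1))"
begin

lemma adj': "grid_adj (f i) (f (i - 1))"
  using adj[of "i - 1"] by (simp add: grid_adj_commute)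

lemma neighbours_distinct: "f (i - 1) \<noteq> f (i + 1)"
  using inj by (simp add: inj_eq)

lemma trace_imp_adj: "trace f u v \<Longrightarrow> grid_adj u v"
  using adj by (auto simp: trace_def doubleton_eq_iff grid_adj_commute)

lemma even_at_trace: "even_at (trace f) u"
proof (cases "u \<in> range f")
  case True
  then obtain i where "u = f i" by blast
  then show ?thesis
    using trace_from[OF inj] adj adj' neighbours_distinct
    by (intro even_atI_two_edges[where p = "f (i - 1)" and q = "f (i + 1)"]) auto
next
  case False
  then have "\<not> trace f u v" for v
    unfolding trace_def by (metis doubleton_eq_iff rangeI)
  then show ?thesis
    by (cases u) (simp add: even_at_def)
qed

end

text \<open>
  Once two consecutive vertices are known, the next vertex is the neighbour in the trace that is
  not the previous one.
\<close>

lemma trace_determines_path: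
  assumes "bi_infinite_path f" "bi_infinite_path g"
    and eq: "trace f = trace g" and start: "f (-1) = g (-1)" "f 0 = g 0"
    and "i \<ge> 0"
  shows "f i = g i"
proof -
  interpret f: bi_infinite_path f by fact
  interpret g: bi_infinite_path g by fact
  have "f (i - 1) = g (i - 1) \<and> f i = g i"
    using \<open>i \<ge> 0\<close>
  proof (induction i rule: int_ge_induct)
    case (step i)
    have "trace g (g i) (f (i + 1))"
      using trace_from[OF f.inj, of i] step.IH eq by metis
    moreover have "f (i + 1) \<noteq> g (i - 1)"
      using f.neighbours_distinct[of i] step.IH by metis
    ultimately have "f (i + 1) = g (i + 1)"
      using trace_from[OF g.inj] by blast
    with step.IH show ?case by simp
  qed (use start in simp)
  then show ?thesis ..
qed

text \<open>
  A walk from \<^term>\<open>(a, a)\<close> to \<^term>\<open>(b, b)\<close> has odd degree at its two ends.  Letting it come in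
  from the left along the line at height \<^term>\<open>a\<close> and go out to the right along the line at
  height \<^term>\<open>b\<close> makes all degrees even and, at the same time, separates the cells of the plane
  into an upper and a lower side.
\<close>

definition prolonged :: "int \<Rightarrow> int \<Rightarrow> (int \<times> int) list \<Rightarrow> int \<Rightarrow> int \<times> int" where
  "prolonged a b w i =
     (if i < 0 then (a + i, a)
      else if i < int (length w) then w ! nat i
      else (b + (i - int (length w) + 1), b))"

text \<open>
  The upper side as far as it is independent of the walk: a cell outside the square
  \<^term>\<open>{a..<b} \<times> {a..<b}\<close> that lies above the left ray, the square or the right ray.
\<close>

definition outer :: "int \<Rightarrow> int \<Rightarrow> (int \<times> int) set" where
  "outer a b = {(x, y). b \<le> y \<or> x < a \<and> a \<le> y}"

text \<open>
  Far up nothing is crossed, so the upper side consists of the cells whose ray has an even number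
  of crossings.  This replaces the Jordan curve theorem.
\<close>

definition above :: "int \<Rightarrow> int \<Rightarrow> (int \<times> int) list \<Rightarrow> (int \<times> int) set" where
  "above a b w = {(x, y). \<not> ray_parity (trace (prolonged a b w)) b x y}"

locale crossing =
  fixes a b :: int and w :: "(int \<times> int) list"
  assumes w: "w \<in> walks ({a..b} \<times> {a..b}) (a, a) (b, b)"
begin

abbreviation f :: "int \<Rightarrow> int \<times> int" where
  "f \<equiv> prolonged a b w"

abbreviation n :: int where
  "n \<equiv> int (length w) - 1"

lemma w_props: "w \<noteq> []" "distinct w" "successively grid_adj w" "hd w = (a, a)" "last w = (b, b)"
    "set w \<subseteq> {a..b} \<times> {a..b}"
  using w by (auto simp: walks_def self_avoiding_walk_def)

lemma n_nonneg: "0 \<le> n"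
  using w_props(1) by (cases w) auto

lemma a_le_b: "a \<le> b"
  using w_props(1,4,6) hd_in_set[of w] by auto

lemma f_left: "i \<le> 0 \<Longrightarrow> f i = (a + i, a)"
  using w_props(1,4) by (auto simp: prolonged_def hd_conv_nth)

lemma f_right: "n \<le> i \<Longrightarrow> f i = (b + (i - n), b)"
proof -
  assume "n \<le> i"
  have "nat n = length w - 1"
    by simp
  then have "w ! nat n = (b, b)"
    using w_props(1,5) by (simp add: last_conv_nth)
  with \<open>n \<le> i\<close> n_nonneg show "f i = (b + (i - n), b)"
    by (cases "i = n") (auto simp: prolonged_def)
qed

lemma f_middle: "0 \<le> i \<Longrightarrow> i \<le> n \<Longrightarrow> f i = w ! nat i"
  by (simp add: prolonged_def)

lemma f_in_square: "0 \<le> i \<Longrightarrow> i \<le> n \<Longrightarrow> f i \<in> {a..b} \<times> {a..b}"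
  using f_middle[of i] nth_mem[of "nat i" w] w_props(6) by auto

lemma f_square_iff: "f i \<in> {a..b} \<times> {a..b} \<longleftrightarrow> 0 \<le> i \<and> i \<le> n"
proof
  assume "f i \<in> {a..b} \<times> {a..b}"
  then show "0 \<le> i \<and> i \<le> n"
    using f_left[of i] f_right[of i] by (cases "0 \<le> i"; cases "i \<le> n") auto
qed (use f_in_square in blast)

sublocale bi_infinite_path f
proof
  show "inj f"
  proof (rule injI)
    fix i j assume eq: "f i = f j"
    consider "0 \<le> i \<and> i \<le> n" "0 \<le> j \<and> j \<le> n" | "i < 0 \<or> n < i" "j < 0 \<or> n < j"
      using eq f_square_iff[of i] f_square_iff[of j] by (metis not_le)
    then show "i = j"
    proof cases
      case 1
      then have "nat i = nat j"
        using eq nth_eq_iff_index_eq[OF w_props(2), of "nat i" "nat j"] by (auto simp: f_middle)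
      with 1 show ?thesis by (simp add: eq_nat_nat_iff)
    next
      case 2
      then show ?thesis
        using eq f_left[of i] f_left[of j] f_right[of i] f_right[of j] a_le_b n_nonneg by auto
    qed
  qed
next
  fix i
  consider "i < 0" | "0 \<le> i" "i < n" | "n \<le> i" by linarith
  then show "grid_adj (f i) (f (i + 1))"
  proof cases
    case 1
    then show ?thesis
      using f_left[of i] f_left[of "i + 1"] by (simp add: grid_adj_def)
  next
    case 2
    have "nat (i + 1) = Suc (nat i)"
      using 2 by simp
    then show ?thesis
      using 2 w_props(3) by (simp add: f_middle successively_conv_nth)
  next
    case 3
    then show ?thesis
      using f_right[of i] f_right[of "i + 1"] by (simp add: grid_adj_def)
  qed
qed

lemma trace_high: "trace f u v \<Longrightarrow> a \<le> snd u \<and> snd u \<le> b"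
proof -
  have "a \<le> snd (f i) \<and> snd (f i) \<le> b" for i
    using f_in_square[of i] f_left[of i] f_right[of i] a_le_b by (cases "f i") force
  then show "trace f u v \<Longrightarrow> a \<le> snd u \<and> snd u \<le> b"
    by (auto simp: trace_def doubleton_eq_iff)
qed

text \<open>
  Horizontal edges change the parity of the ray from one row to the next by definition of the ray;
  vertical edges do so from one column to the next because the prolonged walk is even everywhere.
\<close>

lemma boundary_above: "boundary (above a b w) = trace f"
proof (intro ext)
  fix u v
  have hstep: "boundary (above a b w) (x, y) (x + 1, y) \<longleftrightarrow> trace f (x, y) (x + 1, y)" for x y
    using ray_parity_step[of "trace f" b x y] trace_high by (auto simp: above_def)
  have vstep: "boundary (above a b w) (x, y) (x, y + 1) \<longleftrightarrow> trace f (x, y) (x, y + 1)" for x y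
    using ray_parity_column[of "trace f" b y "x - 1"] trace_high trace_commute even_at_trace
    by (auto simp: above_def)
  show "boundary (above a b w) u v \<longleftrightarrow> trace f u v"
  proof (cases "grid_adj u v")
    case True
    obtain x y where u: "u = (x, y)" by (cases u)
    from True have "grid_adj (x, y) v"
      by (simp add: u)
    then show ?thesis
    proof (cases rule: grid_adj_cases)
      case 1
      then show ?thesis using hstep u by simp
    next
      case 2
      then show ?thesis
        using hstep[of "x - 1" y] boundary_commute[of _ u v] trace_commute[of f u v] u by simp
    next
      case 3
      then show ?thesis using vstep u by simp
    next
      case 4
      then show ?thesis
        using vstep[of x "y - 1"] boundary_commute[of _ u v] trace_commute[of f u v] u by simp
    qed
  next
    case False
    then show ?thesis
      using boundary_imp_adj trace_imp_adj by blast
  qed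
qed

lemma trace_in_range: "trace f u v \<Longrightarrow> u \<in> range f \<and> v \<in> range f"
  by (auto simp: trace_def doubleton_eq_iff)

lemma f_left_of_square: "f i = (x, j) \<Longrightarrow> x < a \<Longrightarrow> j = a"
  using f_left[of i] f_right[of i] f_in_square[of i] a_le_b by (cases "i \<le> 0"; cases "n \<le> i") auto

lemma f_right_of_square: "f i = (x, j) \<Longrightarrow> b < x \<Longrightarrow> j = b"
  using f_left[of i] f_right[of i] f_in_square[of i] a_le_b by (cases "i \<le> 0"; cases "n \<le> i") auto

lemma trace_left: "x < a \<Longrightarrow> trace f (x, j) (x + 1, j) \<longleftrightarrow> j = a"
  using trace_in_range[of "(x, j)" "(x + 1, j)"] f_left_of_square[of _ x j]
    trace_from[OF inj, of "x - a" "(x + 1, a)"] f_left[of "x - a"] f_left[of "x - a + 1"]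
  by auto

lemma trace_right: "b \<le> x \<Longrightarrow> trace f (x, j) (x + 1, j) \<longleftrightarrow> j = b"
  using trace_in_range[of "(x, j)" "(x + 1, j)"] f_right_of_square[of _ "x + 1" j]
    trace_from[OF inj, of "x - b + n" "(x + 1, b)"] f_right[of "x - b + n"] f_right[of "x - b + n + 1"]
  by auto

text \<open>
  Left and right of the square a vertical ray can only cross one of the two prolonging rays.
  Above the square it crosses nothing.  Below the square there are no vertical edges, so that the
  side of a cell is the same as further to the left.
\<close>

lemma above_outside:
  assumes "(x, y) \<notin> {a..<b} \<times> {a..<b}"
  shows "(x, y) \<in> above a b w \<longleftrightarrow> (x, y) \<in> outer a b"
proof -
  have left: "(x, y) \<in> above a b w \<longleftrightarrow> a \<le> y" if "x < a" for x y
  proof -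
    have "{j \<in> {y<..b}. trace f (x, j) (x + 1, j)} = (if y < a then {a} else {})"
      using a_le_b by (auto simp: trace_left[OF that])
    then show ?thesis
      by (auto simp: above_def ray_parity_def)
  qed
  consider "x < a" | "b \<le> x" | "a \<le> x" "x < b" "b \<le> y" | "a \<le> x" "x < b" "y < a"
    using assms by fastforce
  then show ?thesis
  proof cases
    case 1
    then show ?thesis
      using left a_le_b by (auto simp: outer_def)
  next
    case 2
    then have "{j \<in> {y<..b}. trace f (x, j) (x + 1, j)} = (if y < b then {b} else {})"
      by (auto simp: trace_right)
    then show ?thesis
      using 2 a_le_b by (auto simp: above_def ray_parity_def outer_def)
  next
    case 3
    then show ?thesis
      by (simp add: above_def outer_def)
  next
    case 4
    have "a - 1 \<le> x" using 4 by simp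
    then have "(x, y) \<notin> above a b w"
    proof (induction x rule: int_ge_induct)
      case base
      then show ?case using left[of "a - 1" y] 4 by simp
    next
      case (step x)
      have "\<not> boundary (above a b w) (x + 1, y) (x + 1, y + 1)"
        using trace_high[of "(x + 1, y)"] 4 by (auto simp: boundary_above)
      with step show ?case by simp
    qed
    then show ?thesis
      using 4 a_le_b by (simp add: outer_def)
  qed
qed

text \<open>
  Both sides of the walk are connected once the square is surrounded by a ring of cells.  Let
  \<open>K\<close> be a closed part of one side.  Since the whole larger square is connected, \<open>K\<close> has a
  neighbouring cell outside, which must lie on the other side; so \<open>K\<close> touches the walk.  At
  every vertex of the walk the boundary of \<open>K\<close> is even and consists of edges of the walk, of
  which there are just two.  So \<open>K\<close> touches all preceding edges too, down to the first edge
  from \<^term>\<open>(a - 1, a)\<close> to \<^term>\<open>(a, a)\<close>, and thus contains the cell next to that edge on its side.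
\<close>

lemma connected_side:
  assumes S: "S = above a b w \<or> S = - above a b w"
  shows "connected_region (S \<inter> {a - 1..b} \<times> {a - 1..b})"
proof -
  define E where "E = {a - 1..b} \<times> {a - 1..b}"
  define c where "c = (if S = above a b w then (a - 1, a) else (a - 1, a - 1))"
  have bdS: "boundary S u v \<longleftrightarrow> trace f u v" for u v
    using S unfolding boundary_above[symmetric] by (auto simp: boundary_def)
  have start: "(a - 1, a) \<in> above a b w" "(a - 1, a - 1) \<notin> above a b w"
    using a_le_b by (simp_all add: above_outside outer_def)
  then have other: "above a b w \<noteq> - above a b w"
    by blast
  have c: "c \<in> S" "{(a - 1, a), (a - 1, a - 1)} \<inter> S = {c}"
    using S start other by (auto simp: c_def)
  have cE: "c \<in> E" "(a - 1, a) \<in> E" "(a - 1, a - 1) \<in> E"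
    using a_le_b by (auto simp: E_def c_def)
  have "connected_region (S \<inter> E)"
  proof (rule connected_regionI[where c = c])
    show "S \<inter> E \<noteq> {}"
      using c cE by blast
  next
    fix K assume K: "K \<subseteq> S \<inter> E" "K \<noteq> {}" and closed: "adj_closed_in (S \<inter> E) K"
    have bdK: "k \<in> K \<Longrightarrow> d \<in> E \<Longrightarrow> d \<notin> K \<Longrightarrow> grid_adj k d \<Longrightarrow> k \<in> S \<and> d \<notin> S" for k d
      using adj_closed_inD[OF closed] K(1) by blast
    have "\<exists>k d. k \<in> K \<and> d \<in> E \<and> d \<notin> K \<and> grid_adj k d"
    proof (rule ccontr)
      assume no: "\<not> ?thesis"
      then have "adj_closed_in E K"
        by (auto simp: adj_closed_in_def)
      moreover have "connected_region E"
        unfolding E_def using a_le_b by (intro connected_region_rectangle) auto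
      ultimately have "E \<subseteq> K"
        using connected_region_subset K by blast
      then show False
        using K(1) c cE by (auto simp: c_def split: if_splits)
    qed
    then obtain k d where kd: "k \<in> K" "d \<in> E" "d \<notin> K" "grid_adj k d"
      by blast
    then have kdS: "k \<in> S" "d \<notin> S" "k \<in> E"
      using bdK[OF kd(1-4)] K(1) by auto
    obtain u v where uv: "\<forall>A. boundary A u v \<longleftrightarrow> (k \<in> A) \<noteq> (d \<in> A)"
        "{u, v} \<subseteq> {fst k..fst k + 1} \<times> {snd k..snd k + 1}"
      using boundary_separates[OF kd(4)] by blast
    have "trace f u v" "boundary K u v"
      using uv(1) kd(1,3) kdS(1,2) bdS[of u v] by auto
    then obtain i where i: "{u, v} = {f i, f (i + 1)}"
      by (auto simp: trace_def)
    have "boundary K (f i) (f (i + 1))"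
      using \<open>boundary K u v\<close> i boundary_commute[of K u v] by (auto simp: doubleton_eq_iff)
    have sub: "fst (f i) \<in> {a - 1..b + 1}" "fst (f (i + 1)) \<in> {a - 1..b + 1}"
      using uv(2) kdS(3) unfolding i E_def by auto
    have "- 1 \<le> i"
      using sub f_left[of i] by (cases "i \<le> 0") auto
    have "i \<le> n"
      using sub f_right[of i] f_right[of "i + 1"] by (cases "n \<le> i") auto
    have backward: "boundary K (f i) (f (i - 1))"
      if "boundary K (f i) (f (i + 1))" "0 \<le> i" "i \<le> n" for i
    proof -
      obtain x y where xy: "f i = (x, y)" by (cases "f i")
      then have "{(x, y), (x - 1, y), (x, y - 1), (x - 1, y - 1)} \<subseteq> E"
        using f_in_square[OF that(2,3)] by (auto simp: E_def)
      then have inE: "(x, y) \<in> E" "(x - 1, y) \<in> E" "(x, y - 1) \<in> E" "(x - 1, y - 1) \<in> E"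
        by auto
      have "boundary S (x, y) v" if "grid_adj (x, y) v" "boundary K (x, y) v" for v
        using that(1)
      proof (cases rule: grid_adj_cases)
        case 1
        then show ?thesis
          using that(2) bdK[of "(x, y)" "(x, y - 1)"] bdK[of "(x, y - 1)" "(x, y)"] inE by (auto simp: grid_adj_commute)
      next
        case 2
        then show ?thesis
          using that(2) bdK[of "(x - 1, y)" "(x - 1, y - 1)"] bdK[of "(x - 1, y - 1)" "(x - 1, y)"] inE
          by (auto simp: grid_adj_commute)
      next
        case 3
        then show ?thesis
          using that(2) bdK[of "(x, y)" "(x - 1, y)"] bdK[of "(x - 1, y)" "(x, y)"] inE
          by (auto simp: grid_adj_commute)
      next
        case 4
        then show ?thesis
          using that(2) bdK[of "(x, y - 1)" "(x - 1, y - 1)"] bdK[of "(x - 1, y - 1)" "(x, y - 1)"] inE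
          by (auto simp: grid_adj_commute)
      qed
      then have "v = f (i + 1) \<or> v = f (i - 1)" if "grid_adj (f i) v" "boundary K (f i) v" for v
        using that trace_from[OF inj] bdS xy by metis
      then have "boundary K (f i) (f (i + 1)) \<longleftrightarrow> boundary K (f i) (f (i - 1))"
        using even_at_boundary adj adj' neighbours_distinct[of i]
        by (intro even_at_two_edges) auto
      with that(1) show ?thesis by blast
    qed
    from \<open>- 1 \<le> i\<close> \<open>i \<le> n\<close> \<open>boundary K (f i) (f (i + 1))\<close> have "boundary K (f (- 1)) (f 0)"
    proof (induction i rule: int_ge_induct)
      case (step i)
      then show ?case
        using backward[of "i + 1"] boundary_commute[of K] by auto
    qed simp
    then have "((a - 1, a) \<in> K) \<noteq> ((a - 1, a - 1) \<in> K)"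
      using boundary_steps(1)[of K "a - 1" a] f_left[of "- 1"] f_left[of 0] by simp
    then obtain e where "e \<in> {(a - 1, a), (a - 1, a - 1)}" "e \<in> K"
      by blast
    moreover have "e \<in> {(a - 1, a), (a - 1, a - 1)} \<inter> S"
      using calculation K(1) by blast
    then have "e \<in> {c}"
      by (simp only: c(2))
    ultimately show "c \<in> K"
      by simp
  qed
  then show ?thesis by (simp add: E_def)
qed

end

section \<open>Every crossing walk gives a configuration\<close>

text \<open>
  The upper side determines its boundary, the boundary is the trace, and the trace determines the
  walk.
\<close>

lemma crossing_eqI:
  assumes "crossing a b w" "crossing a b w'"
    and E: "{a..<b} \<times> {a..<b} \<subseteq> E" and eq: "above a b w \<inter> E = above a b w' \<inter> E"
  shows "w = w'"
proof -
  interpret w: crossing a b w by fact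
  interpret w': crossing a b w' by fact
  have "c \<in> above a b w \<longleftrightarrow> c \<in> above a b w'" for c
  proof (cases "c \<in> {a..<b} \<times> {a..<b}")
    case True
    then show ?thesis using E eq by blast
  next
    case False
    then show ?thesis
      using w.above_outside w'.above_outside by (cases c) blast
  qed
  then have "above a b w = above a b w'"
    by blast
  then have traces: "trace w.f = trace w'.f"
    using w.boundary_above w'.boundary_above by metis
  have same: "w.f i = w'.f i" if "i \<ge> 0" for i
  proof (rule trace_determines_path[OF _ _ traces _ _ that])
    show "w.f (- 1) = w'.f (- 1)" "w.f 0 = w'.f 0"
      by (simp_all only: w.f_left w'.f_left)
  qed (rule w.bi_infinite_path_axioms w'.bi_infinite_path_axioms)+
  have "w'.f w.n = w'.f w'.n"
    using same[OF w.n_nonneg] w.f_right[of w.n] w'.f_right[of w'.n] by simp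
  then have n: "w.n = w'.n"
    using w'.inj by (simp only: inj_eq)
  show "w = w'"
  proof (rule nth_equalityI)
    show "length w = length w'"
      using n by simp
    fix i assume "i < length w"
    then show "w ! i = w' ! i"
      using same[of "int i"] w.f_middle[of "int i"] w'.f_middle[of "int i"] n by simp
  qed
qed

lemma two_regions_in_configurations:
  assumes "A \<subseteq> cells L" "connected_region A" "connected_region (cells L - A)"
  shows "{A, cells L - A} \<in> configurations L"
proof -
  have "A \<noteq> {}" "cells L - A \<noteq> {}"
    using assms(2,3) by (auto simp: connected_region_def)
  then have "A \<noteq> cells L - A"
    using assms(1) by blast
  then have "card {A, cells L - A} = 2"
    by simp
  moreover have "partition_on (cells L) {A, cells L - A}"
    using assms(1) \<open>A \<noteq> {}\<close> \<open>cells L - A \<noteq> {}\<close> by (auto simp: partition_on_def disjoint_def)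
  ultimately show ?thesis
    using assms(2,3) by (auto simp: configurations_def)
qed

lemma configurationsE:
  assumes "P \<in> configurations L"
  obtains A where "P = {A, cells L - A}" "A \<subseteq> cells L" "connected_region A" "connected_region (cells L - A)"
proof -
  have P: "partition_on (cells L) P" "card P = 2" "\<forall>R\<in>P. connected_region R"
    using assms by (auto simp: configurations_def)
  obtain A B where AB: "P = {A, B}" "A \<noteq> B"
    using P(2) by (auto simp: card_2_iff)
  have "A \<union> B = cells L" "A \<inter> B = {}"
    using P(1) AB by (auto simp: partition_on_def disjoint_def)
  then have "B = cells L - A" "A \<subseteq> cells L"
    by auto
  then show ?thesis
    using that[of A] AB P(3) by simp
qed

text \<open>
  The walks of the \<open>L \<times> L\<close> square, placed in the middle of the square of side \<^term>\<open>L + 2\<close>, so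
  that a ring of cells of width one surrounds them.
\<close>

definition shifted_walks :: "nat \<Rightarrow> (int \<times> int) list set" where
  "shifted_walks L = walks ({1..int L + 1} \<times> {1..int L + 1}) (1, 1) (int L + 1, int L + 1)"

lemma card_WCAS_le_shifted_walks: "card (WCAS L) \<le> card (shifted_walks L)"
proof -
  define \<phi> :: "int \<times> int \<Rightarrow> int \<times> int" where "\<phi> = (\<lambda>(x, y). (x + 1, y + 1))"
  have "card (WCAS L) \<le> card (walks (\<phi> ` ({0..int L} \<times> {0..int L})) (\<phi> (0, 0)) (\<phi> (int L, int L)))"
    unfolding WCAS_eq_walks
    by (rule card_walks_image) (auto simp: \<phi>_def inj_def grid_adj_def)
  also have "\<dots> \<le> card (shifted_walks L)"
  proof -
    have "\<phi> ` ({0..int L} \<times> {0..int L}) \<subseteq> {1..int L + 1} \<times> {1..int L + 1}"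
      by (auto simp: \<phi>_def)
    then show ?thesis
      unfolding shifted_walks_def
      by (simp add: \<phi>_def card_walks_mono)
  qed
  finally show ?thesis .
qed

lemma crossing_shifted_walks: "w \<in> shifted_walks L \<Longrightarrow> crossing 1 (int L + 1) w"
  by (simp add: crossing_def shifted_walks_def)

lemma cells_Suc_Suc: "cells (Suc (Suc L)) = {0..int L + 1} \<times> {0..int L + 1}"
  by (auto simp: cells_def)

lemma inj_on_above:
  "inj_on (\<lambda>w. above 1 (int L + 1) w \<inter> cells (L + 2)) (shifted_walks L)"
proof (rule inj_onI)
  fix w w' assume w: "w \<in> shifted_walks L" "w' \<in> shifted_walks L"
    and eq: "above 1 (int L + 1) w \<inter> cells (L + 2) = above 1 (int L + 1) w' \<inter> cells (L + 2)"
  show "w = w'"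
  proof (rule crossing_eqI[OF w[THEN crossing_shifted_walks] _ eq])
    show "{1..<int L + 1} \<times> {1..<int L + 1} \<subseteq> cells (L + 2)"
      by (auto simp: cells_Suc_Suc)
  qed
qed

lemma card_WCAS_le_power: "card (WCAS L) \<le> 2 ^ (L + 2)\<^sup>2"
proof -
  have "card (shifted_walks L) \<le> card (Pow (cells (L + 2)))"
    by (rule card_inj_on_le[OF inj_on_above]) (auto simp: cells_def)
  also have "\<dots> = 2 ^ (L + 2)\<^sup>2"
    by (simp add: card_Pow cells_def power2_eq_square nat_add_distrib)
  finally show ?thesis
    using card_WCAS_le_shifted_walks order.trans by blast
qed

text \<open>
  A configuration is an unordered pair of regions.  The upper side of the walk is the region that
  contains the cell \<^term>\<open>(0, 1)\<close>, which is next to the left ray; so it can be read off the pair.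
\<close>

lemma card_WCAS_le_configurations: "card (WCAS L) \<le> card (configurations (L + 2))"
proof -
  define S where "S w = above 1 (int L + 1) w \<inter> cells (L + 2)" for w
  have "card (shifted_walks L) \<le> card (configurations (L + 2))"
  proof (rule card_inj_on_le[where f = "\<lambda>w. {S w, cells (L + 2) - S w}"])
    have mem: "(0, 1) \<in> S w" if "w \<in> shifted_walks L" for w
      using crossing.above_outside[OF crossing_shifted_walks[OF that], of 0 1]
      by (simp add: S_def cells_Suc_Suc outer_def)
    show "inj_on (\<lambda>w. {S w, cells (L + 2) - S w}) (shifted_walks L)"
    proof (rule inj_onI)
      fix w w' assume w: "w \<in> shifted_walks L" "w' \<in> shifted_walks L"
      assume "{S w, cells (L + 2) - S w} = {S w', cells (L + 2) - S w'}"
      then have "S w = S w' \<or> S w = cells (L + 2) - S w'"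
        unfolding doubleton_eq_iff by blast
      with mem[OF w(1)] mem[OF w(2)] have "S w = S w'"
        by blast
      then show "w = w'"
        unfolding S_def by (rule inj_onD[OF inj_on_above _ w])
    qed
    show "(\<lambda>w. {S w, cells (L + 2) - S w}) ` shifted_walks L \<subseteq> configurations (L + 2)"
    proof clarify
      fix w assume "w \<in> shifted_walks L"
      then interpret crossing 1 "int L + 1" w
        by (rule crossing_shifted_walks)
      have "cells (L + 2) - S w = - above 1 (int L + 1) w \<inter> cells (L + 2)"
        by (auto simp: S_def)
      then show "{S w, cells (L + 2) - S w} \<in> configurations (L + 2)"
        using connected_side[of "above 1 (int L + 1) w"] connected_side[of "- above 1 (int L + 1) w"]
        by (intro two_regions_in_configurations) (auto simp: S_def cells_Suc_Suc)
    qed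
    show "finite (configurations (L + 2))"
      by (rule finite_configurations)
  qed
  then show ?thesis
    using card_WCAS_le_shifted_walks order.trans by blast
qed

section \<open>Regions as upper sides of crossing walks\<close>

lemma outer_disjoint: "outer a b \<inter> {a..<b} \<times> {a..<b} = {}"
  by (auto simp: outer_def)

text \<open>
  The set \<open>T\<close> extends a region \<open>X\<close> of the square by the upper part of the outside.  Its boundary
  contains the two rays and otherwise stays in the square, where it consists of the interface
  between \<open>X\<close> and its complement together with those edges of the frame at which the colour inside
  and the colour outside differ.
\<close>

context
  fixes a b :: int and X :: "(int \<times> int) set"
  assumes ab: "a < b" and X: "X \<subseteq> {a..<b} \<times> {a..<b}"
begin

abbreviation (input) T :: "(int \<times> int) set" where "T \<equiv> X \<union> outer a b"

lemma in_T_outside: "(x, y) \<notin> {a..<b} \<times> {a..<b} \<Longrightarrow> (x, y) \<in> T \<longleftrightarrow> (x, y) \<in> outer a b"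
  using X by blast

lemma boundary_outside:
  assumes "boundary T u v" "u \<notin> {a..b} \<times> {a..b}"
  shows "\<exists>x. x < a \<and> u = (x, a) \<and> (v = (x + 1, a) \<or> v = (x - 1, a)) \<or>
             b < x \<and> u = (x, b) \<and> (v = (x + 1, b) \<or> v = (x - 1, b))"
proof -
  obtain x y where u: "u = (x, y)" by (cases u)
  have out: "x < a \<or> b < x \<or> y < a \<or> b < y"
    using assms(2) by (auto simp: u)
  then have cells: "(x, y) \<in> T \<longleftrightarrow> (x, y) \<in> outer a b" "(x - 1, y) \<in> T \<longleftrightarrow> (x - 1, y) \<in> outer a b"
    "(x, y - 1) \<in> T \<longleftrightarrow> (x, y - 1) \<in> outer a b" "(x - 1, y - 1) \<in> T \<longleftrightarrow> (x - 1, y - 1) \<in> outer a b"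
    by (intro in_T_outside; auto)+
  have "grid_adj (x, y) v"
    using assms(1) boundary_imp_adj u by blast
  then show ?thesis
  proof (cases rule: grid_adj_cases)
    case 1
    have "((x, y) \<in> outer a b) \<noteq> ((x, y - 1) \<in> outer a b)"
      using assms(1) unfolding u 1 boundary_steps cells .
    then show ?thesis
      using 1 u out ab by (auto simp: outer_def)
  next
    case 2
    have "((x - 1, y) \<in> outer a b) \<noteq> ((x - 1, y - 1) \<in> outer a b)"
      using assms(1) unfolding u 2 boundary_steps cells .
    then show ?thesis
      using 2 u out ab by (auto simp: outer_def)
  next
    case 3
    have "((x, y) \<in> outer a b) \<noteq> ((x - 1, y) \<in> outer a b)"
      using assms(1) unfolding u 3 boundary_steps cells .
    then show ?thesis
      using 3 u out ab by (auto simp: outer_def)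
  next
    case 4
    have "((x, y - 1) \<in> outer a b) \<noteq> ((x - 1, y - 1) \<in> outer a b)"
      using assms(1) unfolding u 4 boundary_steps cells .
    then show ?thesis
      using 4 u out ab by (auto simp: outer_def)
  qed
qed

lemma boundary_rays:
  "x < a \<Longrightarrow> boundary T (x, a) (x + 1, a)"
  "b \<le> x \<Longrightarrow> boundary T (x, b) (x + 1, b)"
  using ab in_T_outside[of x a] in_T_outside[of x "a - 1"] in_T_outside[of x b] in_T_outside[of x "b - 1"]
  by (auto simp: outer_def)

definition edge_inside :: "int \<times> int \<Rightarrow> int \<times> int \<Rightarrow> bool" where
  "edge_inside u v \<longleftrightarrow> boundary T u v \<and> u \<in> {a..b} \<times> {a..b} \<and> v \<in> {a..b} \<times> {a..b}"

lemma joined_in_square: "edge_inside\<^sup>*\<^sup>* (a, a) v \<Longrightarrow> v \<in> {a..b} \<times> {a..b}"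
  by (induction rule: rtranclp_induct) (use ab in \<open>auto simp: edge_inside_def\<close>)

text \<open>
  Suppose that the corner \<^term>\<open>(b, b)\<close> is not reached from \<^term>\<open>(a, a)\<close> along the boundary of
  \<open>T\<close>.  Then the part of the boundary that is reached, with the left ray, is even at every
  vertex.  By the degree sum over a vertical line, the number of its horizontal edges has the same
  parity in all columns.  But there is exactly one in the column left of the square, on the ray,
  and none in the column right of the square.
\<close>

lemma corners_joined: "edge_inside\<^sup>*\<^sup>* (a, a) (b, b)"
proof (rule ccontr)
  assume not_joined: "\<not> ?thesis"
  define K where "K = {v. edge_inside\<^sup>*\<^sup>* (a, a) v} \<union> {(x, a) | x. x < a}"
  define F where "F u v \<longleftrightarrow> boundary T u v \<and> u \<in> K" for u v
  have K_in: "fst v \<le> b \<and> a \<le> snd v \<and> snd v \<le> b \<and> (fst v < a \<longrightarrow> snd v = a)" if "v \<in> K" for v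
    using that joined_in_square[of v] ab by (auto simp: K_def)
  have K_inner: "v \<in> K" if "edge_inside\<^sup>*\<^sup>* (a, a) v" for v
    using that by (simp add: K_def)
  have K_ray: "(x, a) \<in> K" if "x < a" for x
    using that by (simp add: K_def)
  have closed: "v \<in> K" if "u \<in> K" "boundary T u v" for u v
  proof -
    consider "edge_inside\<^sup>*\<^sup>* (a, a) u" "v \<in> {a..b} \<times> {a..b}"
      | "edge_inside\<^sup>*\<^sup>* (a, a) u" "v \<notin> {a..b} \<times> {a..b}"
      | x where "x < a" "u = (x, a)"
      using \<open>u \<in> K\<close> unfolding K_def by blast
    then show ?thesis
    proof cases
      case 1
      then have "edge_inside u v"
        using joined_in_square \<open>boundary T u v\<close> by (simp add: edge_inside_def)
      with 1(1) have "edge_inside\<^sup>*\<^sup>* (a, a) v"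
        by (rule rtranclp.rtrancl_into_rtrancl)
      then show ?thesis
        by (rule K_inner)
    next
      case 2
      have "boundary T v u"
        using that(2) boundary_commute by blast
      from boundary_outside[OF this 2(2)] obtain x where
        "x < a \<and> v = (x, a) \<or> b < x \<and> (u = (x + 1, b) \<or> u = (x - 1, b))"
        by blast
      moreover have "u \<noteq> (b, b)"
        using 2(1) not_joined by blast
      then have "\<not> (b < x \<and> (u = (x + 1, b) \<or> u = (x - 1, b)))"
        using joined_in_square[OF 2(1)] by auto
      ultimately show ?thesis
        using K_ray by blast
    next
      case 3
      then have "u \<notin> {a..b} \<times> {a..b}"
        by simp
      from boundary_outside[OF that(2) this] have "v = (x + 1, a) \<or> v = (x - 1, a)"
        using 3 ab by auto
      moreover have "(x + 1, a) \<in> K"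
        using 3(1) K_ray[of "x + 1"] K_inner[of "(a, a)"] by (cases "x + 1 = a") auto
      moreover have "(x - 1, a) \<in> K"
        using 3(1) by (simp add: K_ray)
      ultimately show ?thesis
        by blast
    qed
  qed
  have sym: "F u v \<longleftrightarrow> F v u" for u v
    using closed boundary_commute unfolding F_def by blast
  have even: "even_at F u" for u
    using even_at_boundary[of T u] by (cases u; cases "u \<in> K") (simp_all add: even_at_def F_def)
  have high: "snd u \<le> b" if "F u v" for u v
    using K_in[of u] that by (simp add: F_def)
  \<comment> \<open>No edge lies below height \<^term>\<open>a\<close>, so this ray meets all horizontal edges of its column.\<close>
  have column: "ray_parity F b x (a - 1) \<longleftrightarrow> ray_parity F b (x + 1) (a - 1)" for x
  proof -
    have "\<not> F (x + 1, a - 1) (x + 1, a - 1 + 1)"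
      using K_in[of "(x + 1, a - 1)"] by (auto simp: F_def)
    moreover have "(ray_parity F b x (a - 1) \<noteq> ray_parity F b (x + 1) (a - 1))
        = F (x + 1, a - 1) (x + 1, a - 1 + 1)"
      by (rule ray_parity_column) (rule sym, erule high, rule even)
    ultimately show ?thesis
      by blast
  qed
  have "ray_parity F b (a - 1) (a - 1) \<longleftrightarrow> ray_parity F b x (a - 1)" if "a - 1 \<le> x" for x
    using that
  proof (induction x rule: int_ge_induct)
    case (step x)
    then show ?case
      using column[of x] by blast
  qed (rule refl)
  from this[of b] have "ray_parity F b (a - 1) (a - 1) \<longleftrightarrow> ray_parity F b b (a - 1)"
    using ab by simp
  moreover have "{j \<in> {a - 1<..b}. F (a - 1, j) (a - 1 + 1, j)} = {a}"
  proof -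
    have "F (a - 1, j) (a - 1 + 1, j) \<longleftrightarrow> j = a" for j
      using K_in[of "(a - 1, j)"] boundary_rays(1)[of "a - 1"] K_ray[of "a - 1"] by (auto simp: F_def)
    then show ?thesis
      using ab by auto
  qed
  then have "ray_parity F b (a - 1) (a - 1)"
    by (simp add: ray_parity_def)
  moreover have "\<not> F (b, j) (b + 1, j)" for j
    using sym[of "(b, j)" "(b + 1, j)"] K_in[of "(b + 1, j)"] by (auto simp: F_def)
  then have "\<not> ray_parity F b b (a - 1)"
    by (simp add: ray_parity_def)
  ultimately show False by blast
qed

text \<open>
  A self-avoiding path between the corners inside the boundary of \<open>T\<close> is a crossing walk, and
  the two rays belong to this boundary as well.
\<close>

lemma crossing_in_boundary:
  "\<exists>w. crossing a b w \<and> (\<forall>u v. boundary (above a b w) u v \<longrightarrow> boundary T u v)"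
proof -
  obtain w where path: "w \<noteq> []" "hd w = (a, a)" "last w = (b, b)" "distinct w"
      "successively edge_inside w" "\<forall>v\<in>set w. edge_inside\<^sup>*\<^sup>* (a, a) v"
    using rtranclp_imp_distinct_path[OF corners_joined] by blast
  have "successively grid_adj w"
    using path(5) by (rule successively_mono) (auto simp: edge_inside_def boundary_imp_adj)
  then have "crossing a b w"
    using path joined_in_square by (auto simp: crossing_def walks_def self_avoiding_walk_def)
  then interpret crossing a b w .
  have "boundary T (f i) (f (i + 1))" for i
  proof -
    consider "i < 0" | "0 \<le> i" "i < n" | "n \<le> i" by linarith
    then show ?thesis
    proof cases
      case 1
      then show ?thesis
        using boundary_rays(1)[of "a + i"] f_left[of i] f_left[of "i + 1"] by (simp add: add.assoc)
    next
      case 2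
      have "nat (i + 1) = Suc (nat i)"
        using 2 by simp
      then show ?thesis
        using 2 path(5) by (simp add: f_middle successively_conv_nth edge_inside_def)
    next
      case 3
      then show ?thesis
        using boundary_rays(2)[of "b + (i - n)"] f_right[of i] f_right[of "i + 1"] by (simp add: algebra_simps)
    qed
  qed
  then have "boundary T u v" if "trace f u v" for u v
    using that boundary_commute[of T u v] by (auto simp: trace_def doubleton_eq_iff)
  then show ?thesis
    using crossing_axioms boundary_above by auto
qed

text \<open>
  Neighbouring cells of equal colour with respect to \<open>T\<close> are on the same side of the walk, since
  the walk only uses edges of the boundary of \<open>T\<close>.  So each of the two regions lies on one side.
  The cell \<^term>\<open>c\<close> ties \<open>X\<close> to the outer cells above the walk, and \<^term>\<open>d\<close> ties the complement
  to the outer cells below.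
\<close>

lemma region_above_crossing:
  assumes conn: "connected_region X" "connected_region ({a..<b} \<times> {a..<b} - X)"
    and c: "c \<in> X" "fst c = a \<or> snd c = b - 1"
    and d: "d \<in> {a..<b} \<times> {a..<b} - X" "snd d = a \<or> fst d = b - 1"
  shows "\<exists>w. crossing a b w \<and> above a b w \<inter> {a..<b} \<times> {a..<b} = X"
proof -
  obtain w where cr: "crossing a b w" "\<forall>u v. boundary (above a b w) u v \<longrightarrow> boundary T u v"
    using crossing_in_boundary by blast
  interpret crossing a b w by fact
  define S where "S = above a b w"
  define Y where "Y = {a..<b} \<times> {a..<b} - X"
  have same: "p \<in> S \<longleftrightarrow> q \<in> S" if "grid_adj p q" "p \<in> T \<longleftrightarrow> q \<in> T" for p q
    using boundary_separates[OF that(1)] cr(2) that(2) unfolding S_def by metis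
  have "X \<subseteq> X \<inter> S"
  proof (rule connected_region_subset[OF conn(1)])
    show "adj_closed_in X (X \<inter> S)"
      using same by (auto simp: adj_closed_in_def)
    obtain x y where xy: "c = (x, y)" by (cases c)
    have "c \<in> S"
    proof (cases "x = a")
      case True
      have "(x - 1, y) \<in> outer a b" "(x - 1, y) \<in> S"
        using True c X above_outside[of "x - 1" y] by (auto simp: outer_def xy S_def)
      then show ?thesis
        using same[of "(x - 1, y)" "(x, y)"] c by (simp add: xy)
    next
      case False
      have "(x, y + 1) \<in> outer a b" "(x, y + 1) \<in> S"
        using False c X above_outside[of x "y + 1"] by (auto simp: outer_def xy S_def)
      then show ?thesis
        using same[of "(x, y + 1)" "(x, y)"] c by (simp add: xy)
    qed
    then show "c \<in> X \<inter> S" "c \<in> X"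
      using c by auto
  qed
  moreover have "Y \<subseteq> Y - S"
  proof (rule connected_region_subset[OF conn(2)[folded Y_def]])
    show "adj_closed_in Y (Y - S)"
      using same outer_disjoint[of a b] by (fastforce simp: adj_closed_in_def Y_def)
    obtain x y where xy: "d = (x, y)" by (cases d)
    have notT: "(x, y) \<notin> T"
      using d outer_disjoint[of a b] by (auto simp: xy)
    have "d \<notin> S"
    proof (cases "y = a")
      case True
      have "(x, y - 1) \<notin> T" "(x, y - 1) \<notin> S"
        using True d X ab above_outside[of x "y - 1"] in_T_outside[of x "y - 1"]
        by (auto simp: outer_def xy S_def)
      then show ?thesis
        using same[of "(x, y - 1)" "(x, y)"] notT by (simp add: xy)
    next
      case False
      have "(x + 1, y) \<notin> T" "(x + 1, y) \<notin> S"
        using False d X ab above_outside[of "x + 1" y] in_T_outside[of "x + 1" y]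
        by (auto simp: outer_def xy S_def)
      then show ?thesis
        using same[of "(x + 1, y)" "(x, y)"] notT by (simp add: xy)
    qed
    then show "d \<in> Y - S" "d \<in> Y"
      using d by (auto simp: Y_def)
  qed
  ultimately have "S \<inter> {a..<b} \<times> {a..<b} = X"
    using X by (auto simp: Y_def)
  then show ?thesis
    using cr(1) by (auto simp: S_def)
qed

end

lemma region_above_WCAS:
  assumes "L \<ge> 1" "X \<subseteq> cells L" "connected_region X" "connected_region (cells L - X)"
    and "c \<in> X" "fst c = 0 \<or> snd c = int L - 1"
    and "d \<in> cells L - X" "snd d = 0 \<or> fst d = int L - 1"
  shows "\<exists>w\<in>WCAS L. above 0 (int L) w \<inter> cells L = X"
  using region_above_crossing[of 0 "int L" X c d] assms
  by (auto simp: cells_def crossing_def WCAS_eq_walks)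

section \<open>The number of configurations is at most the number of walks times the area\<close>

definition column_above :: "int \<times> int \<Rightarrow> (int \<times> int) set" where
  "column_above c = {(x, y). x = fst c \<and> snd c < y}"

lemma connected_add_column:
  assumes A: "A \<subseteq> cells L" "connected_region A" "(x0, y0) \<in> A"
  shows "connected_region (A \<union> column_above (x0, y0) \<inter> cells L)" (is "connected_region ?A")
proof (rule connected_regionI[where c = "(x0, y0)"])
  show "?A \<noteq> {}" using A(3) by blast
next
  fix K assume K: "K \<subseteq> ?A" "K \<noteq> {}" and closed: "adj_closed_in ?A K"
  have "K \<inter> A \<noteq> {}"
  proof
    assume disj: "K \<inter> A = {}"
    have "(x0, y) \<notin> K" if "y0 \<le> y" for y
      using that
    proof (induction y rule: int_ge_induct)
      case base
      show ?case using disj A(3) by blast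
    next
      case (step y)
      show ?case
      proof
        assume up: "(x0, y + 1) \<in> K"
        then have "(x0, y + 1) \<in> cells L" "(x0, y0) \<in> cells L"
          using K(1) A by blast+
        then have "(x0, y) \<in> ?A"
          using step.hyps A(3) by (cases "y = y0") (auto simp: column_above_def cells_def)
        then show False
          using adj_closed_inD[OF closed up] step.IH by simp
      qed
    qed
    moreover obtain k where "k \<in> K"
      using K(2) by blast
    moreover have "k \<in> column_above (x0, y0)"
      using K(1) disj \<open>k \<in> K\<close> by blast
    ultimately show False
      by (cases k) (auto simp: column_above_def)
  qed
  then obtain a where a: "a \<in> K" "a \<in> A" by blast
  have "adj_closed_in A K"
    using closed by (auto simp: adj_closed_in_def)
  from connected_region_subset[OF A(2) this a] show "(x0, y0) \<in> K"
    using A(3) by blast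
qed

definition frame :: "nat \<Rightarrow> (int \<times> int) set" where
  "frame L = {(x, y) \<in> cells L. x = 0 \<or> y = 0 \<or> x = int L - 1 \<or> y = int L - 1}"

text \<open>
  The column above a topmost cell of an enclosed region is cut out of the surrounding region.
  What is left contains the other cells in the rows above, which are joined to each other along the
  left, lower and right edges of the square.  A path of the surrounding region meets the column
  only through these cells, so it can be stopped there.
\<close>

lemma connected_remove_column:
  assumes B: "B \<subseteq> cells L" "connected_region B"
    and frame: "frame L \<subseteq> B"
    and top: "(x0, y0) \<in> cells L - B" "\<And>x y. (x, y) \<in> cells L \<Longrightarrow> y0 < y \<Longrightarrow> (x, y) \<in> B"
  shows "connected_region (B - column_above (x0, y0))" (is "connected_region ?B")
proof -
  let ?C = "column_above (x0, y0)"
  have xy0: "0 < x0" "x0 < int L - 1" "0 < y0" "y0 < int L - 1"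
    using top(1) frame by (fastforce simp: frame_def cells_def)+
  then have origin: "(0, 0) \<in> ?B"
    using frame by (auto simp: frame_def cells_def column_above_def)
  show ?thesis
  proof (rule connected_regionI[where c = "(0, 0)"])
    show "?B \<noteq> {}" using origin by blast
  next
    fix K assume K: "K \<subseteq> ?B" "K \<noteq> {}" and closed: "adj_closed_in ?B K"
    define Z where "Z = ?B - K"
    have Z: "(x, y) \<in> Z \<Longrightarrow> (x', y') \<in> ?B \<Longrightarrow> grid_adj (x, y) (x', y') \<Longrightarrow> (x', y') \<in> Z" for x y x' y'
      using adj_closed_in_Diff[OF closed] by (auto simp: Z_def adj_closed_in_def)
    show "(0, 0) \<in> K"
    proof (rule ccontr)
      assume "(0, 0) \<notin> K"
      then have base: "(0, 0) \<in> Z"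
        using origin by (simp add: Z_def)
      \<comment> \<open>The part \<open>Z\<close> that contains the origin spreads along the frame and from there into the upper rows.\<close>
      have bottom: "(x, 0) \<in> Z" if "0 \<le> x" "x < int L" for x
        using that
      proof (induction x rule: int_ge_induct)
        case (step x)
        then have "(x + 1, 0) \<in> ?B"
          using frame xy0 by (auto simp: frame_def cells_def column_above_def)
        with step show ?case
          using Z[of x 0 "x + 1" 0] by simp
      qed (rule base)
      have left: "(0, y) \<in> Z" if "0 \<le> y" "y < int L" for y
        using that
      proof (induction y rule: int_ge_induct)
        case (step y)
        then have "(0, y + 1) \<in> ?B"
          using frame xy0 by (auto simp: frame_def cells_def column_above_def)
        with step show ?case
          using Z[of 0 y 0 "y + 1"] by simp
      qed (rule base)
      have right: "(int L - 1, y) \<in> Z" if "0 \<le> y" "y < int L" for y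
        using that
      proof (induction y rule: int_ge_induct)
        case base
        show ?case using bottom[of "int L - 1"] xy0 by simp
      next
        case (step y)
        then have "(int L - 1, y + 1) \<in> ?B"
          using frame xy0 by (auto simp: frame_def cells_def column_above_def)
        with step show ?case
          using Z[of "int L - 1" y "int L - 1" "y + 1"] by simp
      qed
      have upper_left: "(x, y) \<in> Z" if "0 \<le> x" "x < x0" "y0 < y" "y < int L" for x y
        using that(1,2)
      proof (induction x rule: int_ge_induct)
        case base
        show ?case using left[of y] that xy0 by simp
      next
        case (step x)
        then have "(x + 1, y) \<in> ?B"
          using top(2)[of "x + 1" y] that(3,4) xy0 by (auto simp: cells_def column_above_def)
        with step show ?case
          using Z[of x y "x + 1" y] by simp
      qed
      have "x \<le> int L - 1 \<Longrightarrow> x0 < x \<Longrightarrow> (x, y) \<in> Z" if "y0 < y" "y < int L" for x y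
      proof (induction x rule: int_le_induct)
        case base
        show ?case using right[of y] that xy0 by simp
      next
        case (step x)
        then have "(x - 1, y) \<in> ?B"
          using top(2)[of "x - 1" y] that xy0 by (auto simp: cells_def column_above_def)
        with step show ?case
          using Z[of x y "x - 1" y] by simp
      qed
      then have upper: "(x, y) \<in> Z" if "(x, y) \<in> cells L" "x \<noteq> x0" "y0 < y" for x y
        using upper_left[of x y] that by (cases "x < x0") (auto simp: cells_def)
      obtain k where k: "k \<in> K" "k \<in> B" "k \<notin> Z"
        using K by (auto simp: Z_def)
      have "adj_closed_in B (Z \<union> ?C)"
        unfolding adj_closed_in_def
      proof (intro ballI impI)
        fix u v assume u: "u \<in> Z \<union> ?C" and v: "v \<in> B" and adj: "grid_adj u v"
        obtain x y x' y' where xy: "u = (x, y)" "v = (x', y')"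
          by (cases u, cases v)
        show "v \<in> Z \<union> ?C"
        proof (cases "v \<in> ?C")
          case False
          with v have vB: "v \<in> ?B" by blast
          show ?thesis
          proof (cases "u \<in> Z")
            case True
            then show ?thesis
              using Z[of x y x' y'] vB adj xy by blast
          next
            case False
            then have c: "x = x0" "y0 < y"
              using u by (auto simp: column_above_def xy)
            have "v \<noteq> (x0, y0)" using v top(1) by blast
            then have "x' \<noteq> x0 \<and> y0 < y'"
              using adj vB c unfolding xy by (auto simp: grid_adj_iff column_above_def)
            then show ?thesis
              using upper[of x' y'] v B(1) xy by blast
          qed
        qed blast
      qed
      then have "B \<subseteq> Z \<union> ?C"
        by (rule connected_region_subset[OF B(2), of _ "(0, 0)"]) (use base origin in auto)
      then show False
        using k K(1) by blast
    qed
  qed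
qed

text \<open>
  If both regions have cells on the frame, one of them has a cell on the left or upper edge and
  the other one a cell on the lower or right edge: the origin lies on both kinds of edges, and the
  region without the origin has a cell on one of them.  Otherwise the region without the origin
  is enclosed, and a column of cells above one of its topmost cells connects it to the upper edge.
  Removing that column from the upper side of the resulting walk gives the region back.
\<close>

lemma region_from_crossing:
  assumes "L \<ge> 1" "A \<subseteq> cells L" "connected_region A" "connected_region (cells L - A)"
    and origin: "(0, 0) \<in> A"
  shows "\<exists>w\<in>WCAS L. \<exists>c\<in>cells L.
    above 0 (int L) w \<inter> cells L - column_above c \<in> {A, cells L - A}"
proof -
  \<comment> \<open>Above the top left cell there is no column to remove.\<close>
  have top_left: "(0, int L - 1) \<in> cells L" "column_above (0, int L - 1) \<inter> cells L = {}"
    using assms(1) by (auto simp: cells_def column_above_def)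
  have twice: "cells L - (cells L - A) = A"
    using assms(2) by blast
  show ?thesis
  proof (cases "frame L \<subseteq> A")
    case False
    then obtain x y where xy: "(x, y) \<in> cells L - A" "x = 0 \<or> y = 0 \<or> x = int L - 1 \<or> y = int L - 1"
      by (auto simp: frame_def)
    have "\<exists>w\<in>WCAS L. above 0 (int L) w \<inter> cells L \<in> {A, cells L - A}"
    proof (cases "y = 0 \<or> x = int L - 1")
      case True
      then show ?thesis
        using region_above_WCAS[OF assms(1-4) origin _ xy(1)] by auto
    next
      case False
      then have "x = 0 \<or> y = int L - 1"
        using xy(2) by blast
      then show ?thesis
        using region_above_WCAS[of L "cells L - A" "(x, y)" "(0, 0)"] assms xy(1) by (auto simp: twice)
    qed
    then obtain w where w: "w \<in> WCAS L" "above 0 (int L) w \<inter> cells L \<in> {A, cells L - A}"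
      by blast
    have "above 0 (int L) w \<inter> cells L - column_above (0, int L - 1) = above 0 (int L) w \<inter> cells L"
      using top_left(2) by blast
    then show ?thesis
      using w top_left(1) by metis
  next
    case True
    define D where "D = cells L - A"
    have D: "D \<subseteq> cells L" "D \<noteq> {}" "finite D" "connected_region D"
      using assms(4) by (auto simp: D_def cells_def connected_region_def)
    define y0 where "y0 = Max (snd ` D)"
    have "y0 \<in> snd ` D"
      unfolding y0_def using D by (intro Max_in) auto
    then obtain x0 where x0: "(x0, y0) \<in> D"
      by auto
    have max: "y \<le> y0" if "(x, y) \<in> D" for x y
      unfolding y0_def using D(3) that by (intro Max_ge) (auto simp: image_iff intro!: bexI[of _ "(x, y)"])
    let ?C = "column_above (x0, y0)"
    let ?D = "D \<union> ?C \<inter> cells L"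
    have below: "D \<inter> ?C = {}"
      by (auto simp: column_above_def dest!: max)
    have compl: "cells L - ?D = A - ?C"
      using assms(2) by (auto simp: D_def)
    have notin: "(x0, y0) \<notin> frame L"
      using True x0 by (auto simp: D_def)
    then have xy0: "0 < x0" "x0 < int L" "0 < y0" "y0 < int L - 1"
      using x0 D(1) by (auto simp: frame_def cells_def)
    have "\<exists>w\<in>WCAS L. above 0 (int L) w \<inter> cells L = ?D"
    proof (rule region_above_WCAS[where c = "(x0, int L - 1)" and d = "(0, 0)"])
      show "connected_region ?D"
        using connected_add_column[OF D(1,4) x0] .
      show "connected_region (cells L - ?D)"
        unfolding compl
      proof (rule connected_remove_column[OF assms(2,3) True])
        show "(x0, y0) \<in> cells L - A"
          using x0 by (simp add: D_def)
        show "(x, y) \<in> A" if "(x, y) \<in> cells L" "y0 < y" for x y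
          using that max[of x y] by (auto simp: D_def)
      qed
    qed (use assms(1) D(1) origin xy0 in \<open>auto simp: cells_def column_above_def D_def\<close>)
    then obtain w where w: "w \<in> WCAS L" "above 0 (int L) w \<inter> cells L = ?D"
      by blast
    have "above 0 (int L) w \<inter> cells L - ?C = cells L - A"
      unfolding w(2) using below by (auto simp: D_def)
    then show ?thesis
      using w(1) x0 D(1) by blast
  qed
qed

lemma card_configurations_le:
  assumes "L \<ge> 1"
  shows "card (configurations L) \<le> L\<^sup>2 * card (WCAS L)"
proof -
  define g where
    "g = (\<lambda>(w, c). let R = above 0 (int L) w \<inter> cells L - column_above c in {R, cells L - R})"
  have "configurations L \<subseteq> g ` (WCAS L \<times> cells L)"
  proof
    fix P assume "P \<in> configurations L"
    then obtain A' where A': "P = {A', cells L - A'}" "A' \<subseteq> cells L" "connected_region A'"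
        "connected_region (cells L - A')"
      by (rule configurationsE)
    define A where "A = (if (0, 0) \<in> A' then A' else cells L - A')"
    have twice: "cells L - (cells L - A') = A'"
      using A'(2) by blast
    have "P = {A, cells L - A}" "A \<subseteq> cells L" "connected_region A" "connected_region (cells L - A)"
      using A' twice by (auto simp: A_def)
    moreover have "(0, 0) \<in> A"
      using assms by (auto simp: A_def cells_def)
    ultimately obtain w c where wc: "w \<in> WCAS L" "c \<in> cells L"
        "above 0 (int L) w \<inter> cells L - column_above c \<in> {A, cells L - A}"
      using region_from_crossing[OF assms] by metis
    have "cells L - (cells L - A) = A"
      using \<open>A \<subseteq> cells L\<close> by blast
    then have "g (w, c) = P"
      using wc(3) \<open>P = {A, cells L - A}\<close> by (auto simp: g_def Let_def)
    then show "P \<in> g ` (WCAS L \<times> cells L)"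
      using wc by blast
  qed
  then have "card (configurations L) \<le> card (g ` (WCAS L \<times> cells L))"
    by (intro card_mono) (auto simp: finite_WCAS cells_def)
  also have "\<dots> \<le> card (WCAS L \<times> cells L)"
    by (intro card_image_le) (auto simp: finite_WCAS cells_def)
  also have "\<dots> = L\<^sup>2 * card (WCAS L)"
    by (simp add: card_cartesian_product cells_def power2_eq_square)
  finally show ?thesis .
qed

section \<open>Tiling rectangles with crossing walks\<close>

definition rect_walks :: "nat \<Rightarrow> nat \<Rightarrow> (int \<times> int) list set" where
  "rect_walks m n = walks ({0..int m} \<times> {0..int n}) (0, 0) (int m, int n)"

lemma WCAS_eq_rect_walks: "WCAS L = rect_walks L L"
  by (simp add: WCAS_eq_walks rect_walks_def)

lemma card_rect_walks_swap: "card (rect_walks m n) \<le> card (rect_walks n m)"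
proof -
  have "prod.swap ` ({0..int m} \<times> {0..int n}) = {0..int n} \<times> {0..int m}"
    by auto
  then show ?thesis
    unfolding rect_walks_def
    using card_walks_image[of prod.swap "{0..int m} \<times> {0..int n}" "(0, 0)" "(int m, int n)"]
    by (auto simp: grid_adj_def)
qed

lemma card_rect_walks_Suc: "card (rect_walks m n) \<le> card (rect_walks (Suc m) n)"
proof -
  let ?q = "(int m + 1, int n)"
  have "[?q] \<in> walks {?q} ?q ?q"
    by (simp add: walks_def self_avoiding_walk_def)
  then have "1 \<le> card (walks {?q} ?q ?q)"
    using finite_walks[of "{?q}"] by (auto simp: Suc_le_eq card_gt_0_iff)
  then have "card (rect_walks m n) \<le> card (rect_walks m n) * card (walks {?q} ?q ?q)"
    by simp
  also have "\<dots> \<le> card (walks ({0..int m} \<times> {0..int n} \<union> {?q}) (0, 0) ?q)"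
    unfolding rect_walks_def by (rule card_walks_join) auto
  also have "\<dots> \<le> card (rect_walks (Suc m) n)"
    unfolding rect_walks_def by (auto intro!: card_walks_mono simp: add.commute)
  finally show ?thesis .
qed

lemma card_rect_walks_mono:
  assumes "m \<le> m'" "n \<le> n'"
  shows "card (rect_walks m n) \<le> card (rect_walks m' n')"
proof -
  have mono: "card (rect_walks m n) \<le> card (rect_walks m' n)" if "m \<le> m'" for m m' n
    using lift_Suc_mono_le[of "\<lambda>m. card (rect_walks m n)", OF card_rect_walks_Suc that] .
  show ?thesis
    using mono[OF assms(1)] mono[OF assms(2)] card_rect_walks_swap order.trans by meson
qed

text \<open>
  Three rectangles in a row, the middle one turned upside down: its walk starts in the upper left
  corner, where the first walk has ended, and arrives in the lower right corner, where the third
  one begins.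
\<close>

lemma card_rect_walks_triple:
  "card (rect_walks k h) * card (rect_walks l h) * card (rect_walks m h)
     \<le> card (rect_walks (k + l + m + 2) h)"
proof -
  define \<phi> :: "int \<times> int \<Rightarrow> int \<times> int" where "\<phi> = (\<lambda>(x, y). (x + int k + 1, int h - y))"
  define \<psi> :: "int \<times> int \<Rightarrow> int \<times> int" where "\<psi> = (\<lambda>(x, y). (x + int k + int l + 2, y))"
  define Q where "Q n = {0..int n} \<times> {0..int h}" for n
  have \<phi>: "card (rect_walks l h) \<le> card (walks (\<phi> ` Q l) (\<phi> (0, 0)) (\<phi> (int l, int h)))"
    unfolding rect_walks_def Q_def
    by (rule card_walks_image) (auto simp: \<phi>_def inj_def grid_adj_def)
  have \<psi>: "card (rect_walks m h) \<le> card (walks (\<psi> ` Q m) (\<psi> (0, 0)) (\<psi> (int m, int h)))"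
    unfolding rect_walks_def Q_def
    by (rule card_walks_image) (auto simp: \<psi>_def inj_def grid_adj_def)
  have fin: "finite (Q n)" for n
    by (simp add: Q_def)
  have "card (rect_walks k h) * card (rect_walks l h) * card (rect_walks m h)
      \<le> card (walks (Q k) (0, 0) (int k, int h)) * card (walks (\<phi> ` Q l) (\<phi> (0, 0)) (\<phi> (int l, int h)))
          * card (walks (\<psi> ` Q m) (\<psi> (0, 0)) (\<psi> (int m, int h)))"
    using \<phi> \<psi> by (intro mult_le_mono) (auto simp: rect_walks_def Q_def)
  also have "\<dots> \<le> card (walks (Q k \<union> \<phi> ` Q l) (0, 0) (\<phi> (int l, int h)))
      * card (walks (\<psi> ` Q m) (\<psi> (0, 0)) (\<psi> (int m, int h)))"
    by (intro mult_le_mono1 card_walks_join)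
       (use fin in \<open>auto simp: Q_def \<phi>_def grid_adj_def\<close>)
  also have "\<dots> \<le> card (walks (Q k \<union> \<phi> ` Q l \<union> \<psi> ` Q m) (0, 0) (\<psi> (int m, int h)))"
    by (rule card_walks_join) (use fin in \<open>auto simp: Q_def \<phi>_def \<psi>_def grid_adj_def\<close>)
  also have "\<dots> \<le> card (rect_walks (k + l + m + 2) h)"
  proof -
    have "Q k \<union> \<phi> ` Q l \<union> \<psi> ` Q m \<subseteq> {0..int (k + l + m + 2)} \<times> {0..int h}"
      by (auto simp: Q_def \<phi>_def \<psi>_def)
    moreover have "\<psi> (int m, int h) = (int (k + l + m + 2), int h)"
      by (simp add: \<psi>_def)
    ultimately show ?thesis
      unfolding rect_walks_def by (simp only: card_walks_mono finite_cartesian_product finite_atLeastAtMost_int)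
  qed
  finally show ?thesis .
qed

lemma card_rect_walks_strip:
  "card (rect_walks m h) ^ (2 * j + 1) \<le> card (rect_walks ((2 * j + 1) * (m + 1) - 1) h)"
proof (induction j)
  case (Suc j)
  let ?M = "(2 * j + 1) * (m + 1) - 1"
  have "card (rect_walks m h) ^ (2 * Suc j + 1)
      = card (rect_walks m h) ^ (2 * j + 1) * card (rect_walks m h) * card (rect_walks m h)"
    by simp
  also have "\<dots> \<le> card (rect_walks ?M h) * card (rect_walks m h) * card (rect_walks m h)"
    using Suc.IH by (intro mult_le_mono1)
  also have "\<dots> \<le> card (rect_walks (?M + m + m + 2) h)"
    by (rule card_rect_walks_triple)
  also have "?M + m + m + 2 = (2 * Suc j + 1) * (m + 1) - 1"
    by (simp add: algebra_simps)
  finally show ?case .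
qed simp

text \<open>
  First an odd number of squares makes up a horizontal strip, then an odd number of strips is
  piled up; after exchanging the coordinates the second step is an instance of the first.
  A square of side \<^term>\<open>m\<close> has \<^term>\<open>m + 1\<close> vertices in each direction, so that the tiles,
  counted in vertices, fit together without overlap.
\<close>

lemma card_WCAS_tiling:
  "card (WCAS m) ^ (2 * j + 1)\<^sup>2 \<le> card (WCAS ((2 * j + 1) * (m + 1) - 1))"
proof -
  let ?M = "(2 * j + 1) * (m + 1) - 1"
  have "card (WCAS m) ^ (2 * j + 1)\<^sup>2 = (card (rect_walks m m) ^ (2 * j + 1)) ^ (2 * j + 1)"
    by (simp only: WCAS_eq_rect_walks power2_eq_square power_mult)
  also have "\<dots> \<le> card (rect_walks ?M m) ^ (2 * j + 1)"
    by (intro power_mono card_rect_walks_strip) simp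
  also have "\<dots> \<le> card (rect_walks m ?M) ^ (2 * j + 1)"
    by (intro power_mono card_rect_walks_swap) simp
  also have "\<dots> \<le> card (rect_walks ?M ?M)"
    by (rule card_rect_walks_strip)
  finally show ?thesis
    by (simp only: WCAS_eq_rect_walks)
qed

lemma card_WCAS_mono: "m \<le> n \<Longrightarrow> card (WCAS m) \<le> card (WCAS n)"
  by (simp add: WCAS_eq_rect_walks card_rect_walks_mono)

lemma card_WCAS_pos: "1 \<le> card (WCAS L)"
proof -
  have "[(0, 0)] \<in> WCAS 0"
    by (simp add: WCAS_def self_avoiding_walk_def)
  then have "1 \<le> card (WCAS 0)"
    using finite_WCAS[of 0] by (auto simp: Suc_le_eq card_gt_0_iff)
  also have "\<dots> \<le> card (WCAS L)"
    by (rule card_WCAS_mono) simp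
  finally show ?thesis .
qed

section \<open>Growth rates per unit of area\<close>

text \<open>
  A version of Fekete's lemma: the limit is the supremum.  Given \<^term>\<open>m\<close>, a large square of side
  \<^term>\<open>L\<close> contains an odd square array of tiles, and at most about two rows of tiles are lost in
  each direction, which is negligible as \<^term>\<open>L\<close> grows.
\<close>

lemma tiling_limit:
  fixes c :: "nat \<Rightarrow> real"
  assumes nonneg: "\<And>m. 0 \<le> c m"
    and mono: "\<And>m n. m \<le> n \<Longrightarrow> c m \<le> c n"
    and bound: "\<And>m. c m \<le> C * (real m + 1)\<^sup>2"
    and tile: "\<And>m j. real ((2 * j + 1)\<^sup>2) * c m \<le> c ((2 * j + 1) * (m + 1) - 1)"
  shows "\<exists>s. (\<lambda>m. c m / (real m + 1)\<^sup>2) \<longlonglongrightarrow> s"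
proof -
  define q where "q m = c m / (real m + 1)\<^sup>2" for m
  have bdd: "bdd_above (range q)"
    using bound by (intro bdd_aboveI[of _ C]) (auto simp: q_def divide_le_eq)
  have lower: "q m * (1 - 2 * (real m + 1) / (real L + 1))\<^sup>2 \<le> q L" if L: "2 * (m + 1) \<le> L + 1" for m L
  proof -
    \<comment> \<open>The number of tiles in each direction is the largest odd number \<open>2 * j + 1\<close> not above \<open>k\<close>.\<close>
    define k where "k = (L + 1) div (m + 1)"
    define j where "j = (k - 1) div 2"
    have k: "2 \<le> k" "k * (m + 1) \<le> L + 1" "L + 1 < (k + 1) * (m + 1)"
      using L dividend_less_div_times[of "m + 1" "L + 1"]
      unfolding k_def by (simp_all only: less_eq_div_iff_mult_less_eq div_times_less_eq_dividend
          add_mult_distrib nat_mult_1 add.commute zero_less_one trans_less_add1 trans_less_add2)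
    have j: "2 * j + 1 \<le> k" "k \<le> 2 * j + 2"
      using k(1) unfolding j_def by linarith+
    have "(2 * j + 1) * (m + 1) \<le> L + 1"
      using mult_le_mono1[OF j(1), of "m + 1"] k(2) by linarith
    then have le: "(2 * j + 1) * (m + 1) - 1 \<le> L"
      by linarith
    have "L + 1 \<le> (2 * j + 3) * (m + 1)"
      using mult_le_mono1[of "k + 1" "2 * j + 3" "m + 1"] k(3) j(2) by linarith
    then have "real (L + 1) \<le> real ((2 * j + 3) * (m + 1))"
      by (simp only: of_nat_le_iff)
    then have upper: "(real L + 1) / (real m + 1) - 2 \<le> 2 * real j + 1"
      by (simp add: field_simps)
    have "real (2 * (m + 1)) \<le> real (L + 1)"
      using L by (simp only: of_nat_le_iff)
    then have "0 \<le> (real L + 1) / (real m + 1) - 2"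
      by (simp add: field_simps)
    then have "((real L + 1) / (real m + 1) - 2)\<^sup>2 \<le> (2 * real j + 1)\<^sup>2"
      using upper by (rule power_mono[rotated])
    then have "((real L + 1) / (real m + 1) - 2)\<^sup>2 * c m \<le> (2 * real j + 1)\<^sup>2 * c m"
      using nonneg by (rule mult_right_mono)
    also have "\<dots> \<le> c ((2 * j + 1) * (m + 1) - 1)"
      using tile[of j m] by (simp add: add.commute)
    also have "\<dots> \<le> c L"
      using le by (rule mono)
    finally have "((real L + 1) / (real m + 1) - 2)\<^sup>2 * c m / (real L + 1)\<^sup>2 \<le> q L"
      unfolding q_def by (rule divide_right_mono) simp
    moreover have "((real L + 1) / (real m + 1) - 2)\<^sup>2 * c m / (real L + 1)\<^sup>2
        = q m * (((real L + 1) / (real m + 1) - 2) * (real m + 1) / (real L + 1))\<^sup>2"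
      by (simp add: q_def power_divide power_mult_distrib)
    moreover have "((real L + 1) / (real m + 1) - 2) * (real m + 1) / (real L + 1)
        = 1 - 2 * (real m + 1) / (real L + 1)"
    proof -
      have "(y / x - 2) * x / y = 1 - 2 * x / y" if "0 < x" "0 < y" for x y :: real
        using that by (simp add: field_simps)
      then show ?thesis by simp
    qed
    ultimately show ?thesis by simp
  qed
  have "q \<longlonglongrightarrow> (SUP m. q m)"
  proof (rule order_tendstoI)
    fix y assume "y < (SUP m. q m)"
    then obtain m where m: "y < q m"
      using less_cSUP_iff[OF _ bdd] by auto
    have "(\<lambda>L. q m * (1 - 2 * (real m + 1) / (real L + 1))\<^sup>2) \<longlonglongrightarrow> q m * (1 - 0)\<^sup>2"
      using LIMSEQ_Suc[OF lim_const_over_n[of "2 * (real m + 1)"]]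
      by (intro tendsto_intros) (simp add: add.commute)
    then have "eventually (\<lambda>L. y < q m * (1 - 2 * (real m + 1) / (real L + 1))\<^sup>2) sequentially"
      using m by (intro order_tendstoD(1)) auto
    then show "eventually (\<lambda>L. y < q L) sequentially"
      using eventually_ge_at_top[of "2 * (m + 1)"]
    proof eventually_elim
      case (elim L)
      then show ?case
        using lower[of m L] by simp
    qed
  next
    fix y assume "(SUP m. q m) < y"
    then have "q L < y" for L
      using cSUP_upper[OF _ bdd, of L] by simp
    then show "eventually (\<lambda>L. q L < y) sequentially"
      by simp
  qed
  then show ?thesis
    unfolding q_def by blast
qed

text \<open>
  Changing the side length by a constant does not affect the growth per unit of area.
\<close>

lemma quadratic_quotient_limit_shift:
  fixes c :: "nat \<Rightarrow> real" and a :: real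
  assumes lim: "(\<lambda>L. c L / (real L + 1)\<^sup>2) \<longlonglongrightarrow> s" and "a \<ge> 0"
  shows "(\<lambda>L. c L / (real L + a)\<^sup>2) \<longlonglongrightarrow> s"
proof -
  let ?r = "\<lambda>L. (1 + 1 / real L) / (1 + a / real L)"
  have "(\<lambda>L. c L / (real L + 1)\<^sup>2 * (?r L)\<^sup>2) \<longlonglongrightarrow> s * ((1 + 0) / (1 + 0))\<^sup>2"
    by (intro tendsto_intros lim lim_const_over_n) simp
  then have "(\<lambda>L. c L / (real L + 1)\<^sup>2 * (?r L)\<^sup>2) \<longlonglongrightarrow> s"
    by simp
  moreover have "eventually (\<lambda>L. c L / (real L + 1)\<^sup>2 * (?r L)\<^sup>2 = c L / (real L + a)\<^sup>2) sequentially"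
    using eventually_gt_at_top[of 0]
  proof eventually_elim
    case (elim L)
    then have "1 + 1 / real L = (real L + 1) / real L" "1 + a / real L = (real L + a) / real L"
      by (simp_all add: field_simps)
    then have "?r L = (real L + 1) / (real L + a)"
      using elim by simp
    then show ?case
      by (simp add: power_divide)
  qed
  ultimately show ?thesis
    by (rule Lim_transform_eventually)
qed

text \<open>
  The upper bound on the number of walks comes from the sets of cells above them, which determine
  the walks.
\<close>

lemma WCAS_rate_limit:
  "\<exists>s. (\<lambda>L. ln (real (card (WCAS L))) / (real L + 1)\<^sup>2) \<longlonglongrightarrow> s"
proof (rule tiling_limit)
  have pos: "1 \<le> real (card (WCAS m))" for m
    using card_WCAS_pos[of m] by linarith
  show "0 \<le> ln (real (card (WCAS m)))" for m
    using pos[of m] by simp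
  show "ln (real (card (WCAS m))) \<le> ln (real (card (WCAS n)))" if "m \<le> n" for m n
    using card_WCAS_mono[OF that] pos[of m] by (intro ln_mono) auto
  show "ln (real (card (WCAS m))) \<le> (4 * ln 2) * (real m + 1)\<^sup>2" for m
  proof -
    have "real (card (WCAS m)) \<le> real (2 ^ (m + 2)\<^sup>2)"
      using card_WCAS_le_power[of m] by (simp only: of_nat_le_iff)
    then have "ln (real (card (WCAS m))) \<le> ln (2 ^ (m + 2)\<^sup>2)"
      using pos[of m] by (intro ln_mono) auto
    also have "\<dots> = real ((m + 2)\<^sup>2) * ln 2"
      by (simp add: ln_realpow)
    also have "\<dots> \<le> (4 * (real m + 1)\<^sup>2) * ln 2"
    proof (rule mult_right_mono)
      have "(real m + 2)\<^sup>2 \<le> (2 * (real m + 1))\<^sup>2"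
        by (intro power_mono) auto
      also have "\<dots> = 4 * (real m + 1)\<^sup>2"
        by (simp only: power_mult_distrib) simp
      finally show "real ((m + 2)\<^sup>2) \<le> 4 * (real m + 1)\<^sup>2"
        by (simp add: add.commute)
    qed simp
    finally show ?thesis by (simp add: mult_ac)
  qed
  show "real ((2 * j + 1)\<^sup>2) * ln (real (card (WCAS m)))
      \<le> ln (real (card (WCAS ((2 * j + 1) * (m + 1) - 1))))" for m j
  proof -
    have "real (card (WCAS m) ^ (2 * j + 1)\<^sup>2) \<le> real (card (WCAS ((2 * j + 1) * (m + 1) - 1)))"
      using card_WCAS_tiling by (simp only: of_nat_le_iff)
    then have "ln (real (card (WCAS m)) ^ (2 * j + 1)\<^sup>2) \<le> ln (real (card (WCAS ((2 * j + 1) * (m + 1) - 1))))"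
      using pos[of m] by (intro ln_mono) auto
    then show ?thesis
      using pos[of m] by (simp add: ln_realpow)
  qed
qed

lemma powr_inverse_square_eq: "0 < x \<Longrightarrow> x powr (1 / real (L\<^sup>2)) = exp (ln x / (real L)\<^sup>2)"
  by (simp add: powr_def)

theorem theorem3:
  shows "convergent (\<lambda>L. real (card (WCAS L)) powr (1 / real (L\<^sup>2))) \<and>
         (\<lambda>L. (poly (gerrymander_poly L) 1 / 2) powr (1 / real (L\<^sup>2)))
           \<longlonglongrightarrow> wcas_growth_constant"
proof -
  define c where "c L = ln (real (card (WCAS L)))" for L
  define g where "g L = ln (real (card (configurations L)))" for L
  obtain s where s: "(\<lambda>L. c L / (real L + 1)\<^sup>2) \<longlonglongrightarrow> s"
    using WCAS_rate_limit by (auto simp: c_def)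
  have W_pos: "0 < real (card (WCAS L))" for L
    using card_WCAS_pos[of L] by linarith
  have "(\<lambda>L. exp (c L / (real L + 0)\<^sup>2)) \<longlonglongrightarrow> exp s"
    by (intro tendsto_exp quadratic_quotient_limit_shift[OF s]) simp
  then have W_lim: "(\<lambda>L. real (card (WCAS L)) powr (1 / real (L\<^sup>2))) \<longlonglongrightarrow> exp s"
    using W_pos by (simp add: powr_inverse_square_eq c_def del: of_nat_power)
  have G_pos: "0 < real (card (configurations (L + 2)))" for L
    using card_WCAS_le_configurations[of L] card_WCAS_pos[of L] by linarith
  have "(\<lambda>L. g (L + 2) / (real L + 2)\<^sup>2) \<longlonglongrightarrow> s"
  proof (rule tendsto_sandwich)
    show "(\<lambda>L. c L / (real L + 2)\<^sup>2) \<longlonglongrightarrow> s"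
      by (intro quadratic_quotient_limit_shift[OF s]) simp
    show "eventually (\<lambda>L. c L / (real L + 2)\<^sup>2 \<le> g (L + 2) / (real L + 2)\<^sup>2) sequentially"
      using card_WCAS_le_configurations W_pos
      by (intro always_eventually allI divide_right_mono) (auto simp: c_def g_def intro!: ln_mono)
    have "(\<lambda>L. 2 * (ln (real L) / real L) * (1 / real L) + c L / (real L + 0)\<^sup>2) \<longlonglongrightarrow> 2 * 0 * 0 + s"
      by (intro tendsto_intros quadratic_quotient_limit_shift[OF s] filterlim_compose[OF ln_x_over_x_tendsto_0 filterlim_real_sequentially]
          lim_const_over_n) simp
    then have "(\<lambda>L. (2 * ln (real L) + c L) / (real L)\<^sup>2) \<longlonglongrightarrow> s"
      by (simp add: add_divide_distrib power2_eq_square)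
    then show "(\<lambda>L. (2 * ln (real (L + 2)) + c (L + 2)) / (real (L + 2))\<^sup>2) \<longlonglongrightarrow> s"
      by (rule LIMSEQ_ignore_initial_segment)
    have "g (L + 2) \<le> 2 * ln (real (L + 2)) + c (L + 2)" for L
    proof -
      have "real (card (configurations (L + 2))) \<le> real ((L + 2)\<^sup>2 * card (WCAS (L + 2)))"
        using card_configurations_le[of "L + 2"] by (simp only: of_nat_le_iff)
      then have "g (L + 2) \<le> ln ((real (L + 2))\<^sup>2 * real (card (WCAS (L + 2))))"
        unfolding g_def using G_pos[of L] by (intro ln_mono) auto
      also have "\<dots> = 2 * ln (real (L + 2)) + c (L + 2)"
        using W_pos[of "L + 2"] by (simp add: c_def ln_mult ln_realpow del: of_nat_add)
      finally show ?thesis .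
    qed
    then show "eventually (\<lambda>L. g (L + 2) / (real L + 2)\<^sup>2
        \<le> (2 * ln (real (L + 2)) + c (L + 2)) / (real (L + 2))\<^sup>2) sequentially"
      by (intro always_eventually allI) (simp add: divide_right_mono add.commute)
  qed
  then have "(\<lambda>L. exp (g (L + 2) / (real (L + 2))\<^sup>2)) \<longlonglongrightarrow> exp s"
    by (intro tendsto_exp) (simp add: add.commute)
  then have "(\<lambda>L. real (card (configurations (L + 2))) powr (1 / real ((L + 2)\<^sup>2))) \<longlonglongrightarrow> exp s"
    using G_pos by (simp only: powr_inverse_square_eq g_def)
  then have "(\<lambda>L. real (card (configurations L)) powr (1 / real (L\<^sup>2))) \<longlonglongrightarrow> exp s"
    by (rule LIMSEQ_offset)
  then have "(\<lambda>L. (poly (gerrymander_poly L) 1 / 2) powr (1 / real (L\<^sup>2))) \<longlonglongrightarrow> exp s"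
    by (simp only: half_gerrymander_poly_1)
  moreover have "wcas_growth_constant = exp s"
    unfolding wcas_growth_constant_def using W_lim by (rule limI)
  ultimately show ?thesis
    using W_lim by (auto simp: convergent_def)
qed

end
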